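(* Let $\rho$ and $\sigma$ be two faithful states (invertible density matrices) on $\mathcal{M}$. Let $\mathcal{E}_\tau$ be the tracial conditional expectation onto a von Neumann subalgebra $\mathcal{N}$ of $\mathcal{M}$, and let $\rho_{\mathcal{N}} = \mathcal{E}_\tau(\rho)$ and $\sigma_{\mathcal{N}} = \mathcal{E}_\tau(\sigma)$. Then, with $\|\cdot\|_1$ denoting the trace norm, $$S(\rho||\sigma) - S(\rho_{\mathcal{N}}||\sigma_{\mathcal{N}}) \ \geq\ \left(\frac{\pi}{8}\right)^{4} \|\Delta_{\sigma,\rho}\|^{-2}\, \big\| \mathcal{R}_\rho(\sigma_{\mathcal{N}}) -\sigma\big\|_1^4 .$$
   Context: $\mathcal{M}$ is a finite dimensional von Neumann algebra, regarded as a unital $*$-subalgebra of $M_n(\mathbb{C})$; $\mathrm{Tr}$ is the trace on $M_n(\mathbb{C})$, $\mathbf{1}$ is the identity, and $\langle X,Y\rangle_{HS}=\mathrm{Tr}[X^*Y]$. The trace norm is $\|A\|_1=\mathrm{Tr}[(A^*A)^{1/2}]$. A von Neumann subalgebra $\mathcal{N}\subset\mathcal{M}$ is a $*$-subalgebra containing $\mathbf{1}$. States on $\mathcal{M}$ are identified with density matrices $\rho\in\mathcal{M}$ ($\rho\ge 0$, $\mathrm{Tr}[\rho]=1$) through $\rho(X)=\mathrm{Tr}[\rho X]$; the state is faithful iff $\rho$ is invertible. The tracial conditional expectation $\mathcal{E}_\tau:\mathcal{M}\to\mathcal{N}$ is the orthogonal projection of $\mathcal{M}$ onto $\mathcal{N}$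 with respect to $\langle\cdot,\cdot\rangle_{HS}$. The Umegaki relative entropy is $S(\rho||\sigma)=\mathrm{Tr}[\rho(\log\rho-\log\sigma)]$. The relative modular operator is $\Delta_{\sigma,\rho}(X)=\sigma X\rho^{-1}$ on $\mathcal{M}$, and $\|\Delta_{\sigma,\rho}\|$ is its operator norm on $(\mathcal{M},\langle\cdot,\cdot\rangle_{HS})$. The Petz recovery map $\mathcal{R}_\rho:\mathcal{N}\to\mathcal{M}$ is $\mathcal{R}_\rho(\gamma)=\rho^{1/2}\rho_{\mathcal{N}}^{-1/2}\gamma\rho_{\mathcal{N}}^{-1/2}\rho^{1/2}$. *)

theory Defs
  imports "HOL-Analysis.Analysis"
begin

definition cadj :: "complex^'n^'n \<Rightarrow> complex^'n^'n" where
  "cadj A = map_matrix cnj (transpose A)"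

definition hs_inner :: "complex^'n^'n \<Rightarrow> complex^'n^'n \<Rightarrow> complex" where
  "hs_inner X Y = trace (cadj X ** Y)"

text \<open>The norm of the type of matrices is the Hilbert--Schmidt norm, and is used as such below.\<close>

lemma norm_eq_hs_inner: "norm X = sqrt (Re (hs_inner X X))"
proof -
  have "Re (hs_inner X X) = (\<Sum>i\<in>UNIV. \<Sum>k\<in>UNIV. (norm (X $ k $ i))\<^sup>2)"
    unfolding cmod_power2
    by (simp add: hs_inner_def trace_def cadj_def transpose_def matrix_matrix_mult_def
        power2_eq_square)
  also have "\<dots> = (\<Sum>k\<in>UNIV. \<Sum>i\<in>UNIV. (norm (X $ k $ i))\<^sup>2)"
    by (rule sum.swap)
  finally show ?thesis
    by (simp add: norm_vec_def L2_set_def sum_nonneg)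
qed

text \<open>In finite dimension, the von Neumann algebras are the unital \<open>*\<close>-subalgebras of the
  algebra of all matrices.\<close>

definition star_subalgebra :: "(complex^'n^'n) set \<Rightarrow> bool" where
  "star_subalgebra S \<longleftrightarrow>
     mat 1 \<in> S \<and>
     (\<forall>A\<in>S. \<forall>B\<in>S. A + B \<in> S \<and> A ** B \<in> S) \<and>
     (\<forall>c. \<forall>A\<in>S. map_matrix ((*) c) A \<in> S) \<and>
     (\<forall>A\<in>S. cadj A \<in> S)"

definition psd :: "complex^'n^'n \<Rightarrow> bool" where
  "psd A \<longleftrightarrow> (\<forall>v. (\<Sum>i\<in>UNIV. cnj (v $ i) * (A *v v) $ i) \<in> \<real>\<^sub>\<ge>\<^sub>0)"

definition faithful_state :: "(complex^'n^'n) set \<Rightarrow> complex^'n^'n \<Rightarrow> bool" where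
  "faithful_state M \<rho> \<longleftrightarrow> \<rho> \<in> M \<and> psd \<rho> \<and> trace \<rho> = 1 \<and> invertible \<rho>"

definition unitary_matrix :: "complex^'n^'n \<Rightarrow> bool" where
  "unitary_matrix U \<longleftrightarrow> cadj U ** U = mat 1 \<and> U ** cadj U = mat 1"

definition real_diag :: "('n \<Rightarrow> real) \<Rightarrow> complex^'n^'n" where
  "real_diag d = (\<chi> i j. if i = j then of_real (d i) else 0)"

text \<open>Functional calculus for Hermitian matrices. Every Hermitian matrix is unitarily
  diagonalizable with real eigenvalues, and the result does not depend on the diagonalization
  (\<open>mat_fun_eqI\<close> below).\<close>

definition mat_fun :: "(real \<Rightarrow> real) \<Rightarrow> complex^'n^'n \<Rightarrow> complex^'n^'n" where
  "mat_fun f A = (THE B. \<exists>U d. unitary_matrix U \<and> A = U ** real_diag d ** cadj U \<and>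
                               B = U ** real_diag (f \<circ> d) ** cadj U)"

lemma real_diag_mult_left: "(real_diag d ** A) $ i $ j = of_real (d i) * A $ i $ j"
  by (simp add: real_diag_def matrix_matrix_mult_def if_distrib[where f = "\<lambda>x. x * _"]
      cong: if_cong)

lemma real_diag_mult_right: "(A ** real_diag d) $ i $ j = A $ i $ j * of_real (d j)"
  by (simp add: real_diag_def matrix_matrix_mult_def if_distrib[where f = "\<lambda>x. _ * x"]
      cong: if_cong)

lemma mat_fun_unique:
  fixes U V :: "complex^'n^'n"
  assumes U: "unitary_matrix U" and V: "unitary_matrix V"
    and eq: "U ** real_diag d ** cadj U = V ** real_diag e ** cadj V"
  shows "U ** real_diag (f \<circ> d) ** cadj U = V ** real_diag (f \<circ> e) ** cadj V"
proof -
  define W where "W = cadj V ** U"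
  have UU: "cadj U ** U = mat 1" "U ** cadj U = mat 1"
    and VV: "cadj V ** V = mat 1" "V ** cadj V = mat 1"
    using U V by (auto simp: unitary_matrix_def)
  have "W ** real_diag d = cadj V ** (U ** real_diag d ** cadj U) ** U"
    by (metis UU(1) W_def matrix_mul_assoc matrix_mul_rid)
  also have "\<dots> = real_diag e ** W"
    unfolding eq by (metis VV(1) W_def matrix_mul_assoc matrix_mul_lid)
  finally have W: "W ** real_diag d = real_diag e ** W" .
  have "W $ i $ j * of_real (f (d j)) = of_real (f (e i)) * W $ i $ j" for i j
  proof -
    have "W $ i $ j * of_real (d j) = of_real (e i) * W $ i $ j"
      using W by (metis real_diag_mult_left real_diag_mult_right)
    then show ?thesis by (cases "W $ i $ j = 0") auto
  qed
  then have "W ** real_diag (f \<circ> d) = real_diag (f \<circ> e) ** W"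
    by (simp add: vec_eq_iff real_diag_mult_left real_diag_mult_right)
  then have "V ** (W ** real_diag (f \<circ> d)) ** cadj U = V ** (real_diag (f \<circ> e) ** W) ** cadj U"
    by simp
  moreover have "V ** (W ** real_diag (f \<circ> d)) ** cadj U = U ** real_diag (f \<circ> d) ** cadj U"
    by (metis VV(2) W_def matrix_mul_assoc matrix_mul_lid)
  moreover have "V ** (real_diag (f \<circ> e) ** W) ** cadj U = V ** real_diag (f \<circ> e) ** cadj V"
    by (metis UU(2) W_def matrix_mul_assoc matrix_mul_rid)
  ultimately show ?thesis by simp
qed

lemma mat_fun_eqI:
  assumes "unitary_matrix U" and "A = U ** real_diag d ** cadj U"
  shows "mat_fun f A = U ** real_diag (f \<circ> d) ** cadj U"
  unfolding mat_fun_def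
proof (rule the_equality)
  show "\<exists>V e. unitary_matrix V \<and> A = V ** real_diag e ** cadj V \<and>
      U ** real_diag (f \<circ> d) ** cadj U = V ** real_diag (f \<circ> e) ** cadj V"
    using assms by blast
next
  fix B
  assume "\<exists>V e. unitary_matrix V \<and> A = V ** real_diag e ** cadj V \<and>
      B = V ** real_diag (f \<circ> e) ** cadj V"
  then show "B = U ** real_diag (f \<circ> d) ** cadj U"
    using assms mat_fun_unique by blast
qed

definition mat_powr :: "complex^'n^'n \<Rightarrow> real \<Rightarrow> complex^'n^'n" where
  "mat_powr A t = mat_fun (\<lambda>x. x powr t) A"

definition mat_log :: "complex^'n^'n \<Rightarrow> complex^'n^'n" where
  "mat_log A = mat_fun ln A"

text \<open>In the next two definitions the trace is a real number whenever the arguments are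
  Hermitian, respectively always; \<open>Re\<close> only serves as the coercion to the type of reals.\<close>

definition rel_entropy :: "complex^'n^'n \<Rightarrow> complex^'n^'n \<Rightarrow> real" where
  "rel_entropy \<rho> \<sigma> = Re (trace (\<rho> ** (mat_log \<rho> - mat_log \<sigma>)))"

definition trace_norm :: "complex^'n^'n \<Rightarrow> real" where
  "trace_norm A = Re (trace (mat_powr (cadj A ** A) (1/2)))"

text \<open>The orthogonal projection onto \<open>N\<close> for the Hilbert--Schmidt inner product. It is
  written on all matrices; on an algebra containing \<open>N\<close> it is the projection of that algebra
  onto \<open>N\<close>.\<close>

definition tracial_cond_exp :: "(complex^'n^'n) set \<Rightarrow> complex^'n^'n \<Rightarrow> complex^'n^'n" where
  "tracial_cond_exp N X = (THE Y. Y \<in> N \<and> (\<forall>Z\<in>N. hs_inner Z (X - Y) = 0))"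

definition rel_modular ::
    "complex^'n^'n \<Rightarrow> complex^'n^'n \<Rightarrow> complex^'n^'n \<Rightarrow> complex^'n^'n" where
  "rel_modular \<sigma> \<rho> X = \<sigma> ** X ** matrix_inv \<rho>"

text \<open>The operator norm on the subspace \<open>M\<close>, in the form of the library's \<open>onorm\<close>: the element
  \<open>0\<close> of \<open>M\<close> contributes the quotient \<open>0 / 0 = 0\<close>.\<close>

definition onorm_on ::
    "(complex^'n^'n) set \<Rightarrow> (complex^'n^'n \<Rightarrow> complex^'n^'n) \<Rightarrow> real" where
  "onorm_on M T = (SUP X\<in>M. norm (T X) / norm X)"

definition petz_recovery ::
    "(complex^'n^'n) set \<Rightarrow> complex^'n^'n \<Rightarrow> complex^'n^'n \<Rightarrow> complex^'n^'n" where
  "petz_recovery N \<rho> \<gamma> =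
     (let \<rho>\<^sub>N = tracial_cond_exp N \<rho> in
      mat_powr \<rho> (1/2) ** mat_powr \<rho>\<^sub>N (-1/2) ** \<gamma> ** mat_powr \<rho>\<^sub>N (-1/2) ** mat_powr \<rho> (1/2))"

end

theory Submission
  imports Defs "HOL-Real_Asymp.Real_Asymp"
begin

text \<open>Let \<open>\<Delta>\<close> and \<open>\<Delta>\<^sub>N\<close> be the relative modular operators of the two pairs of states. The map
  \<open>U X = X \<rho>\<^sub>N\<^sup>-\<^sup>1\<^sup>/\<^sup>2 \<rho>\<^sup>1\<^sup>/\<^sup>2\<close> is an isometry on \<open>N\<close> with \<open>U\<^sup>* \<Delta> U = \<Delta>\<^sub>N\<close> and
  \<open>U \<rho>\<^sub>N\<^sup>1\<^sup>/\<^sup>2 = \<rho>\<^sup>1\<^sup>/\<^sup>2 = e\<close>. With \<open>u\<^sub>t = (t + \<Delta>)\<^sup>-\<^sup>1 e\<close>,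
  \<open>v\<^sub>t = U (t + \<Delta>\<^sub>N)\<^sup>-\<^sup>1 \<rho>\<^sub>N\<^sup>1\<^sup>/\<^sup>2\<close> and \<open>w\<^sub>t = v\<^sub>t - u\<^sub>t\<close>, completing the square gives
  \<open>\<langle>e, u\<^sub>t\<rangle> - \<langle>e, v\<^sub>t\<rangle> = \<langle>w\<^sub>t, (t + \<Delta>) w\<^sub>t\<rangle> \<ge> t \<parallel>w\<^sub>t\<parallel>\<^sup>2\<close>. Integrating in \<open>t\<close>, the left-hand
  side becomes the entropy difference \<open>D\<close>, while \<open>\<pi>\<close> times the difference of
  \<open>\<Delta>\<^sup>1\<^sup>/\<^sup>2 e = \<sigma>\<^sup>1\<^sup>/\<^sup>2\<close> and \<open>U \<Delta>\<^sub>N\<^sup>1\<^sup>/\<^sup>2 \<rho>\<^sub>N\<^sup>1\<^sup>/\<^sup>2 = \<sigma>\<^sub>N\<^sup>1\<^sup>/\<^sup>2 \<rho>\<^sub>N\<^sup>-\<^sup>1\<^sup>/\<^sup>2 \<rho>\<^sup>1\<^sup>/\<^sup>2\<close> is the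
  integral of \<open>t\<^sup>1\<^sup>/\<^sup>2 w\<^sub>t\<close>. Up to a cutoff \<open>T\<close> this integral has norm at most
  \<open>(T D)\<^sup>1\<^sup>/\<^sup>2\<close>, beyond it at most \<open>4 \<parallel>\<Delta>\<parallel> T\<^sup>-\<^sup>1\<^sup>/\<^sup>2\<close>; the optimal \<open>T\<close> gives the bound with
  \<open>\<pi> / 4\<close>. The Gram matrices of the two vectors are \<open>\<sigma>\<close> and the recovered state, and passing to
  them costs a factor \<open>2\<close>.\<close>

section \<open>Square roots and resolvents of a positive operator\<close>

text \<open>The optimisation over the cutoff \<open>T\<close> and over the weight
  \<open>\<epsilon>\<close> that stands in for Cauchy-Schwarz under an integral.\<close>

lemma quartic_bound_of_trade_off:
  fixes n D L :: real
  assumes "n \<ge> 0" "D \<ge> 0" "L > 0"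
    and bound: "\<And>\<epsilon> T. \<epsilon> > 0 \<Longrightarrow> T > 0 \<Longrightarrow> pi * n \<le> (\<epsilon> * D + T / \<epsilon>) / 2 + 4 * L / sqrt T"
  shows "(pi / 4 * n) ^ 4 \<le> L\<^sup>2 * D"
proof (rule field_le_epsilon)
  fix \<delta> :: real assume "\<delta> > 0"
  \<comment> \<open>No optimal cutoff exists for \<open>D = 0\<close>, so \<open>D\<close> is first
    made strictly positive; the shift is scaled so that it costs exactly \<open>\<delta>\<close>
    after multiplication by \<open>L\<^sup>2\<close>.\<close>
  define D' where "D' = D + \<delta> / L\<^sup>2"
  have D': "D' > 0" "D \<le> D'" using assms \<open>\<delta> > 0\<close> by (auto simp: D'_def add_nonneg_pos)
  define q where "q = root 4 D'"
  define p where "p = sqrt L"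
  have q: "q > 0" "q ^ 4 = D'" using D' by (auto simp: q_def)
  have p: "p > 0" "p\<^sup>2 = L" using assms by (auto simp: p_def)
  \<comment> \<open>With these choices \<open>\<epsilon> * D'\<close>, \<open>T / \<epsilon>\<close>
    and \<open>4 * L / sqrt T\<close> all equal \<open>2 * p * q\<close>, so the right-hand side
    balances at \<open>4 * p * q\<close>.\<close>
  define T where "T = (2 * p / q)\<^sup>2"
  define \<epsilon> where "\<epsilon> = 2 * p / q ^ 3"
  have T: "T > 0" "sqrt T = 2 * p / q" and e: "\<epsilon> > 0" using p q by (auto simp: T_def \<epsilon>_def)
  have "pi * n \<le> (\<epsilon> * D + T / \<epsilon>) / 2 + 4 * L / sqrt T" using bound e T by blast
  also have "\<dots> \<le> (\<epsilon> * D' + T / \<epsilon>) / 2 + 4 * L / sqrt T" using e D' by simp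
  also have "\<epsilon> * D' = 2 * p * q" unfolding q(2)[symmetric] \<epsilon>_def using q
    by (simp add: field_simps power_eq_if)
  also have "T / \<epsilon> = 2 * p * q" unfolding \<epsilon>_def T_def using p q
    by (simp add: field_simps power_eq_if)
  also have "4 * L / sqrt T = 2 * p * q" unfolding T p(2)[symmetric] using p q
    by (simp add: field_simps power_eq_if)
  finally have "pi / 4 * n \<le> p * q" by simp
  then have "(pi / 4 * n) ^ 4 \<le> (p * q) ^ 4" using assms by (intro power_mono) auto
  also have "\<dots> = L\<^sup>2 * D'" unfolding p(2)[symmetric] q(2)[symmetric] by (simp add: field_simps)
  also have "\<dots> = L\<^sup>2 * D + \<delta>" using assms by (simp add: D'_def field_simps)
  finally show "(pi / 4 * n) ^ 4 \<le> L\<^sup>2 * D + \<delta>" .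
qed

section \<open>Orthogonal expansions and the resolvent estimate\<close>

lemma inner_sum_orthogonal:
  fixes a :: "'k \<Rightarrow> 'a::real_inner"
  assumes "finite K" "\<And>k k'. k \<in> K \<Longrightarrow> k' \<in> K \<Longrightarrow> k \<noteq> k' \<Longrightarrow> inner (a k) (a k') = 0"
  shows "inner (\<Sum>k\<in>K. f k *\<^sub>R a k) (\<Sum>k\<in>K. g k *\<^sub>R a k) = (\<Sum>k\<in>K. f k * g k * (norm (a k))\<^sup>2)"
proof -
  have "inner (\<Sum>k\<in>K. f k *\<^sub>R a k) (\<Sum>k\<in>K. g k *\<^sub>R a k)
      = (\<Sum>k\<in>K. \<Sum>k'\<in>K. f k * g k' * inner (a k) (a k'))"
    unfolding inner_sum_left unfolding inner_sum_right by (simp add: mult_ac)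
  also have "\<dots> = (\<Sum>k\<in>K. \<Sum>k'\<in>K. if k' = k then f k * g k * (norm (a k))\<^sup>2 else 0)"
    using assms by (intro sum.cong refl) (auto simp: power2_norm_eq_inner)
  also have "\<dots> = (\<Sum>k\<in>K. f k * g k * (norm (a k))\<^sup>2)"
    using assms(1) by (simp add: sum.delta)
  finally show ?thesis .
qed

lemma norm_sum_orthogonal_le:
  fixes a :: "'k \<Rightarrow> 'a::real_inner"
  assumes "finite K" "\<And>k k'. k \<in> K \<Longrightarrow> k' \<in> K \<Longrightarrow> k \<noteq> k' \<Longrightarrow> inner (a k) (a k') = 0"
    and le: "\<And>k. k \<in> K \<Longrightarrow> \<bar>f k\<bar> \<le> \<bar>g k\<bar>"
  shows "norm (\<Sum>k\<in>K. f k *\<^sub>R a k) \<le> norm (\<Sum>k\<in>K. g k *\<^sub>R a k)"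
proof -
  have "(\<Sum>k\<in>K. f k * f k * (norm (a k))\<^sup>2) \<le> (\<Sum>k\<in>K. g k * g k * (norm (a k))\<^sup>2)"
    unfolding power2_eq_square[of "f _", symmetric] power2_eq_square[of "g _", symmetric]
    by (intro sum_mono mult_right_mono) (auto simp: abs_le_square_iff[symmetric] le)
  moreover have "inner (\<Sum>k\<in>K. h k *\<^sub>R a k) (\<Sum>k\<in>K. h k *\<^sub>R a k)
      = (\<Sum>k\<in>K. h k * h k * (norm (a k))\<^sup>2)" for h
    by (rule inner_sum_orthogonal) (use assms in auto)
  ultimately show ?thesis by (simp add: norm_le)
qed

text \<open>The antiderivative rises from 0 at \<open>t = 0\<close> to \<open>pi * sqrt l\<close> at
  infinity, which is the integral representation of \<open>sqrt l\<close>.\<close>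

lemma DERIV_two_sqrt_arctan:
  assumes "l > 0" "t > 0"
  shows "((\<lambda>t. 2 * sqrt l * arctan (sqrt t / sqrt l)) has_real_derivative l / (sqrt t * (t + l))) (at t)"
proof -
  have "((\<lambda>t. 2 * sqrt l * arctan (sqrt t / sqrt l)) has_real_derivative
     2 * sqrt l * (inverse (1 + (sqrt t / sqrt l)\<^sup>2) * ((inverse (sqrt t) / 2) / sqrt l))) (at t)"
    using assms by (auto intro!: derivative_eq_intros)
  also have "2 * sqrt l * (inverse (1 + (sqrt t / sqrt l)\<^sup>2) * ((inverse (sqrt t) / 2) / sqrt l))
     = l / (sqrt t * (t + l))"
  proof -
    have "1 + (sqrt t / sqrt l)\<^sup>2 = (t + l) / l" using assms by (simp add: power_divide field_simps)
    then show ?thesis using assms by (simp add: divide_simps)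
  qed
  finally show ?thesis .
qed

text \<open>Resolvents enter through the antiderivative \<open>F\<close> of
  \<open>\<langle>u\<^sub>t - v\<^sub>t, e\<rangle>\<close> and the antiderivative \<open>\<Phi>\<close> of
  \<open>sqrt t * \<langle>z, w\<^sub>t\<rangle>\<close>, which replace the integral representations of
  \<open>ln\<close> and \<open>sqrt\<close>; all estimates become monotonicity statements about real functions.\<close>

lemma sqrt_difference_bound:
  fixes a :: "'k \<Rightarrow> 'a::real_inner" and c :: "'l \<Rightarrow> 'a"
  assumes K: "finite K" and I: "finite I"
    and a_orth: "\<And>k k'. k \<in> K \<Longrightarrow> k' \<in> K \<Longrightarrow> k \<noteq> k' \<Longrightarrow> inner (a k) (a k') = 0"
    and c_orth: "\<And>l l'. l \<in> I \<Longrightarrow> l' \<in> I \<Longrightarrow> l \<noteq> l' \<Longrightarrow> inner (c l) (c l') = 0"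
    and \<kappa>: "\<And>k. k \<in> K \<Longrightarrow> \<kappa> k > 0" and \<mu>: "\<And>l. l \<in> I \<Longrightarrow> \<mu> l > 0"
    and lin: "linear T" and sym: "\<And>x y. inner x (T y) = inner (T x) y"
    and pos: "\<And>x. 0 \<le> inner x (T x)"
    and Ta: "\<And>k. k \<in> K \<Longrightarrow> T (a k) = \<kappa> k *\<^sub>R a k"
    and Tc: "\<And>l l'. l \<in> I \<Longrightarrow> l' \<in> I \<Longrightarrow> inner (c l') (T (c l)) = \<mu> l * inner (c l') (c l)"
    and ea: "e = (\<Sum>k\<in>K. a k)" and ec: "e = (\<Sum>l\<in>I. c l)"
    and L: "L > 0" "norm (T e) \<le> L"
  shows "(pi / 4 * norm ((\<Sum>k\<in>K. sqrt (\<kappa> k) *\<^sub>R a k) - (\<Sum>l\<in>I. sqrt (\<mu> l) *\<^sub>R c l))) ^ 4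
     \<le> L\<^sup>2 * ((\<Sum>l\<in>I. (norm (c l))\<^sup>2 * ln (\<mu> l)) - (\<Sum>k\<in>K. (norm (a k))\<^sup>2 * ln (\<kappa> k)))"
proof -
  \<comment> \<open>\<open>u t\<close> is the resolvent of \<open>T\<close> at \<open>e\<close>,
    expanded in eigenvectors; \<open>v t\<close> is the same expression for the compression of
    \<open>T\<close> to the span of the \<open>c l\<close>.\<close>
  define u where "u t = (\<Sum>k\<in>K. (1 / (t + \<kappa> k)) *\<^sub>R a k)" for t
  define v where "v t = (\<Sum>l\<in>I. (1 / (t + \<mu> l)) *\<^sub>R c l)" for t
  define w where "w t = v t - u t" for t
  define F where "F t = (\<Sum>k\<in>K. (norm (a k))\<^sup>2 * (ln (t + \<kappa> k) - ln (\<kappa> k)))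
      - (\<Sum>l\<in>I. (norm (c l))\<^sup>2 * (ln (t + \<mu> l) - ln (\<mu> l)))" for t
  define F' where "F' t = (\<Sum>k\<in>K. (norm (a k))\<^sup>2 / (t + \<kappa> k)) - (\<Sum>l\<in>I. (norm (c l))\<^sup>2 / (t + \<mu> l))" for t
  define D where "D = (\<Sum>l\<in>I. (norm (c l))\<^sup>2 * ln (\<mu> l)) - (\<Sum>k\<in>K. (norm (a k))\<^sup>2 * ln (\<kappa> k))"
  define y where "y = (\<Sum>k\<in>K. sqrt (\<kappa> k) *\<^sub>R a k) - (\<Sum>l\<in>I. sqrt (\<mu> l) *\<^sub>R c l)"
  \<comment> \<open>Testing against \<open>z\<close> turns the norm of \<open>y\<close> into a
    scalar: \<open>inner z y = norm y\<close>. For \<open>y = 0\<close> the value is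
    \<open>z = 0\<close>, hence only \<open>norm z \<le> 1\<close> is used.\<close>
  define z where "z = sgn y"
  define \<Phi> where "\<Phi> t = (\<Sum>k\<in>K. inner z (a k) * (2 * sqrt (\<kappa> k) * arctan (sqrt t / sqrt (\<kappa> k))))
      - (\<Sum>l\<in>I. inner z (c l) * (2 * sqrt (\<mu> l) * arctan (sqrt t / sqrt (\<mu> l))))" for t
  define \<Phi>' where "\<Phi>' t = (\<Sum>k\<in>K. inner z (a k) * (\<kappa> k / (sqrt t * (t + \<kappa> k))))
      - (\<Sum>l\<in>I. inner z (c l) * (\<mu> l / (sqrt t * (t + \<mu> l))))" for t
  have z: "norm z \<le> 1" by (simp add: z_def norm_sgn)
  interpret T: linear T by (rule lin)
  have pos_k: "t + \<kappa> k > 0" if "k \<in> K" "t \<ge> 0" for t k using \<kappa>[OF that(1)] that(2) by simp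
  have pos_l: "t + \<mu> l > 0" if "l \<in> I" "t \<ge> 0" for t l using \<mu>[OF that(1)] that(2) by simp

  have TS: "t *\<^sub>R u t + T (u t) = e" if "t \<ge> 0" for t
  proof -
    have "t *\<^sub>R u t + T (u t) = (\<Sum>k\<in>K. (t / (t + \<kappa> k)) *\<^sub>R a k + (\<kappa> k / (t + \<kappa> k)) *\<^sub>R a k)"
      by (simp add: u_def T.sum T.scale Ta scaleR_sum_right sum.distrib)
    also have "\<dots> = (\<Sum>k\<in>K. a k)"
      using pos_k that by (intro sum.cong refl)
        (smt (verit, ccfv_threshold) add_divide_distrib divide_self_if scaleR_add_left scaleR_one)
    finally show ?thesis by (simp add: ea)
  qed
  \<comment> \<open>\<open>Tc\<close> is an eigenvalue equation only up to compression, so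
    \<open>v t\<close> is shown to solve the resolvent equation only when tested against the
    \<open>c l'\<close>.\<close>
  have cv: "inner (c l') (t *\<^sub>R v t + T (v t)) = inner (c l') e" if "t \<ge> 0" "l' \<in> I" for t l'
  proof -
    have "inner (c l') (t *\<^sub>R v t + T (v t))
        = (\<Sum>l\<in>I. t / (t + \<mu> l) * inner (c l') (c l) + \<mu> l / (t + \<mu> l) * inner (c l') (c l))"
      using that by (simp add: v_def T.sum T.scale Tc scaleR_sum_right sum.distrib
          inner_add_right inner_sum_right)
    also have "\<dots> = (\<Sum>l\<in>I. inner (c l') (c l))"
    proof (rule sum.cong[OF refl])
      fix l assume "l \<in> I"
      then have "t + \<mu> l \<noteq> 0" using pos_l[OF \<open>l \<in> I\<close> that(1)] by simp
      then show "t / (t + \<mu> l) * inner (c l') (c l) + \<mu> l / (t + \<mu> l) * inner (c l') (c l) = inner (c l') (c l)"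
        by (simp add: divide_simps) (simp add: algebra_simps)
    qed
    finally show ?thesis by (simp add: ec inner_sum_right)
  qed
  have ve: "inner (v t) e = (\<Sum>l\<in>I. (norm (c l))\<^sup>2 / (t + \<mu> l))" for t
    using inner_sum_orthogonal[where a = c and f = "\<lambda>l. 1 / (t + \<mu> l)" and g = "\<lambda>_. 1", OF I c_orth]
    by (simp add: v_def ec)
  have ue: "inner (u t) e = (\<Sum>k\<in>K. (norm (a k))\<^sup>2 / (t + \<kappa> k))" for t
    using inner_sum_orthogonal[where a = a and f = "\<lambda>k. 1 / (t + \<kappa> k)" and g = "\<lambda>_. 1", OF K a_orth]
    by (simp add: u_def ea)
  \<comment> \<open>Completing the square: in the quadratic form of \<open>t + T\<close> at
    \<open>v t - u t\<close>, the diagonal term of \<open>v t\<close> and both cross terms have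
    absolute value \<open>inner (v t) e\<close>. What remains is
    \<open>inner (u t) e - inner (v t) e\<close>, which is \<open>F' t\<close>.\<close>
  have F'_ge: "F' t \<ge> t * (norm (w t))\<^sup>2" if "t \<ge> 0" for t
  proof -
    have "inner (v t) (t *\<^sub>R v t + T (v t)) = inner (v t) e"
    proof -
      have v: "inner (v t) x = (\<Sum>l\<in>I. 1 / (t + \<mu> l) * inner (c l) x)" for x
        by (simp add: v_def inner_sum_left)
      show ?thesis unfolding v[of "_ + _"] v[of e] using cv that by (intro sum.cong refl) simp
    qed
    moreover have "inner (v t) (t *\<^sub>R u t + T (u t)) = inner (v t) e"
        "inner (u t) (t *\<^sub>R u t + T (u t)) = inner (u t) e"
      using TS that by auto
    moreover have "inner (u t) (T (v t)) = inner (v t) (T (u t))"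
      using sym[of "u t" "v t"] by (simp add: inner_commute)
    ultimately have "inner (w t) (t *\<^sub>R w t + T (w t)) = inner (u t) e - inner (v t) e"
      by (simp add: w_def T.diff inner_diff_left inner_diff_right inner_add_right
          inner_commute[of "u t" "v t"] algebra_simps)
    then have "F' t = t * (norm (w t))\<^sup>2 + inner (w t) (T (w t))"
      by (simp add: F'_def ve ue inner_add_right power2_norm_eq_inner)
    then show ?thesis using pos by simp
  qed
  have F_deriv: "(F has_real_derivative F' t) (at t)" if "t \<ge> 0" for t
    unfolding F_def F'_def using pos_k pos_l that
    by (auto intro!: derivative_eq_intros sum.cong)
  have F_mono: "F s \<le> F t" if "0 \<le> s" "s \<le> t" for s t
  proof (rule DERIV_nonneg_imp_nondecreasing[OF that(2)])
    fix x assume "s \<le> x" "x \<le> t"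
    then have "x \<ge> 0" using that by simp
    moreover have "F' x \<ge> 0" using F'_ge[of x] \<open>x \<ge> 0\<close>
      by (meson order_trans mult_nonneg_nonneg zero_le_power2)
    ultimately show "\<exists>y. (F has_real_derivative y) (at x) \<and> 0 \<le> y" using F_deriv by blast
  qed
  have norm_e: "(\<Sum>k\<in>K. (norm (a k))\<^sup>2) = (\<Sum>l\<in>I. (norm (c l))\<^sup>2)"
    using inner_sum_orthogonal[where a = a and f = "\<lambda>_. 1" and g = "\<lambda>_. 1", OF K a_orth]
      inner_sum_orthogonal[where a = c and f = "\<lambda>_. 1" and g = "\<lambda>_. 1", OF I c_orth]
    by (simp add: ea[symmetric] ec[symmetric])
  have F_lim: "(F \<longlongrightarrow> D) at_top"
  proof -
    \<comment> \<open>Both families have total weight \<open>(norm e)\<^sup>2\<close>, so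
      subtracting \<open>ln t\<close> inside every logarithm changes nothing, and each difference of
      logarithms then tends to 0.\<close>
    have F_eq: "F t = (\<Sum>k\<in>K. (norm (a k))\<^sup>2 * ((ln (t + \<kappa> k) - ln t) - ln (\<kappa> k)))
      - (\<Sum>l\<in>I. (norm (c l))\<^sup>2 * ((ln (t + \<mu> l) - ln t) - ln (\<mu> l)))" for t
      using norm_e by (simp add: F_def algebra_simps sum.distrib sum_subtractf
          sum_distrib_left[symmetric] sum_distrib_right[symmetric])
    have "((\<lambda>t. ln (t + l) - ln t) \<longlongrightarrow> 0) at_top" for l :: real by real_asymp
    then have "(F \<longlongrightarrow> (\<Sum>k\<in>K. (norm (a k))\<^sup>2 * (0 - ln (\<kappa> k)))
      - (\<Sum>l\<in>I. (norm (c l))\<^sup>2 * (0 - ln (\<mu> l)))) at_top"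
      unfolding F_eq by (intro tendsto_intros)
    then show ?thesis by (simp add: D_def sum_negf)
  qed
  have F_le: "F t \<le> D" if "t \<ge> 0" for t
    by (rule tendsto_lowerbound[OF F_lim]) (use F_mono that in \<open>auto intro!: eventually_at_top_linorderI\<close>)
  have "F 0 = 0" by (simp add: F_def)
  then have D: "D \<ge> 0" using F_le[of 0] by simp

  have \<Phi>_deriv: "(\<Phi> has_real_derivative \<Phi>' t) (at t)" if "t > 0" for t
    unfolding \<Phi>_def \<Phi>'_def
    by (intro DERIV_diff DERIV_sum DERIV_cmult DERIV_two_sqrt_arctan \<kappa> \<mu> that)
  have \<Phi>_cont: "continuous_on {0..T} \<Phi>" for T
    unfolding \<Phi>_def by (intro continuous_intros) (use \<kappa> \<mu> in force)+
  have \<Phi>_lim: "(\<Phi> \<longlongrightarrow> pi * norm y) at_top"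
  proof -
    have lim: "((\<lambda>t. arctan (sqrt t / sqrt l)) \<longlongrightarrow> pi / 2) at_top" if "l > 0" for l :: real
      using that by real_asymp
    have "(\<Phi> \<longlongrightarrow> (\<Sum>k\<in>K. inner z (a k) * (2 * sqrt (\<kappa> k) * (pi / 2)))
      - (\<Sum>l\<in>I. inner z (c l) * (2 * sqrt (\<mu> l) * (pi / 2)))) at_top"
      unfolding \<Phi>_def by (intro tendsto_intros lim \<kappa> \<mu>)
    also have "(\<Sum>k\<in>K. inner z (a k) * (2 * sqrt (\<kappa> k) * (pi / 2)))
      - (\<Sum>l\<in>I. inner z (c l) * (2 * sqrt (\<mu> l) * (pi / 2))) = pi * inner z y"
      by (simp add: y_def inner_diff_right inner_sum_right sum_distrib_left algebra_simps)
    also have "inner z y = norm y"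
      by (cases "y = 0") (simp_all add: z_def sgn_div_norm power2_norm_eq_inner[symmetric] power2_eq_square)
    finally show ?thesis .
  qed
  have \<Phi>'_eq: "\<Phi>' t = sqrt t * inner z (w t)" if "t > 0" for t
  proof -
    \<comment> \<open>Only the second term depends on \<open>l\<close>. The first one contributes
      \<open>inner z e * (sqrt t / t)\<close> to both sums, since both families add up to
      \<open>e\<close>, and cancels.\<close>
    have frac: "l / (sqrt t * (t + l)) = sqrt t / t - sqrt t * (1 / (t + l))" if "l > 0" for l
    proof -
      obtain r where "r > 0" "t = r * r"
        using \<open>t > 0\<close> by (metis real_sqrt_gt_zero real_sqrt_mult_self abs_of_pos)
      moreover from this have "r * r + l > 0" using that by (simp add: add_pos_pos)
      ultimately show ?thesis by (simp add: divide_simps algebra_simps)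
    qed
    have "\<Phi>' t = (\<Sum>k\<in>K. inner z (a k) * (sqrt t / t - sqrt t * (1 / (t + \<kappa> k))))
      - (\<Sum>l\<in>I. inner z (c l) * (sqrt t / t - sqrt t * (1 / (t + \<mu> l))))"
      unfolding \<Phi>'_def using frac \<kappa> \<mu> by (intro arg_cong2[where f="(-)"] sum.cong) auto
    also have "\<dots> = (inner z e * (sqrt t / t) - sqrt t * inner z (u t))
        - (inner z e * (sqrt t / t) - sqrt t * inner z (v t))"
      unfolding right_diff_distrib sum_subtractf
      by (subst ea, subst ec) (simp add: inner_sum_right sum_distrib_left sum_distrib_right u_def v_def mult_ac)
    finally show ?thesis by (simp add: w_def inner_diff_right algebra_simps)
  qed
  \<comment> \<open>Young's inequality with weight \<open>\<epsilon>\<close>, applied pointwise to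
    \<open>sqrt t * norm (w t)\<close>, bounds \<open>\<Phi>'\<close> by an expression linear in
    \<open>F'\<close>. The comparison is thus a monotonicity statement starting from the value
    0.\<close>
  have near: "\<Phi> T \<le> (\<epsilon> * D + T / \<epsilon>) / 2" if "\<epsilon> > 0" "T > 0" for \<epsilon> T
  proof -
    have "(\<epsilon> * F 0 + 0 / \<epsilon>) / 2 - \<Phi> 0 \<le> (\<epsilon> * F T + T / \<epsilon>) / 2 - \<Phi> T"
    \<comment> \<open>The derivative of \<open>\<Phi>\<close> is available for \<open>t > 0\<close>
      only; at the left endpoint continuity suffices.\<close>
    proof (rule DERIV_nonneg_imp_increasing_open[where a = 0 and b = T
          and f = "\<lambda>t. (\<epsilon> * F t + t / \<epsilon>) / 2 - \<Phi> t"])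
      fix t assume t: "0 < t" "t < T"
      have "sqrt t * inner z (w t) \<le> sqrt t * norm (w t)"
        using norm_cauchy_schwarz[of z "w t"] mult_left_le_one_le[OF _ norm_ge_zero z, of "norm (w t)"] t
        by (intro mult_left_mono) auto
      also have "\<dots> \<le> (\<epsilon> * (t * (norm (w t))\<^sup>2) + 1 / \<epsilon>) / 2"
      proof -
        have "0 \<le> (\<epsilon> * (sqrt t * norm (w t)) - 1)\<^sup>2 / (2 * \<epsilon>)" using that by simp
        also have "\<dots> = (\<epsilon> * (t * (norm (w t))\<^sup>2) + 1 / \<epsilon>) / 2 - sqrt t * norm (w t)"
          using that t by (simp add: field_simps power2_eq_square)
        finally show ?thesis by simp
      qed
      also have "\<dots> \<le> (\<epsilon> * F' t + 1 / \<epsilon>) / 2"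
        using F'_ge[of t] t that by simp
      finally have "0 \<le> (\<epsilon> * F' t + 1 / \<epsilon>) / 2 - \<Phi>' t" using \<Phi>'_eq t by simp
      moreover have "((\<lambda>t. (\<epsilon> * F t + t / \<epsilon>) / 2 - \<Phi> t) has_real_derivative
          ((\<epsilon> * F' t + 1 / \<epsilon>) / 2 - \<Phi>' t)) (at t)"
        using t by (intro DERIV_diff[OF DERIV_cdivide[OF DERIV_add[OF DERIV_cmult[OF F_deriv]
              DERIV_cdivide[OF DERIV_ident]]] \<Phi>_deriv]) simp_all
      ultimately show "\<exists>y. ((\<lambda>t. (\<epsilon> * F t + t / \<epsilon>) / 2 - \<Phi> t) has_real_derivative y) (at t) \<and> 0 \<le> y"
        by blast
    next
      have "continuous_on {0..T} F"
        by (rule DERIV_continuous_on, rule has_field_derivative_at_within, rule F_deriv) simp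
      then show "continuous_on {0..T} (\<lambda>t. (\<epsilon> * F t + t / \<epsilon>) / 2 - \<Phi> t)"
        using that by (intro continuous_intros \<Phi>_cont) auto
    qed (use that in auto)
    moreover have "\<Phi> 0 = 0" by (simp add: \<Phi>_def)
    moreover have "\<epsilon> * F T \<le> \<epsilon> * D" using F_le[of T] that by simp
    ultimately show ?thesis using \<open>F 0 = 0\<close> by simp
  qed
  have Te_c: "norm (\<Sum>l\<in>I. \<mu> l *\<^sub>R c l) \<le> L"
  proof -
    \<comment> \<open>\<open>g\<close> is the orthogonal projection of \<open>T e\<close> onto the
      span of the \<open>c l\<close>, so its norm is at most that of \<open>T e\<close>.\<close>
    define g where "g = (\<Sum>l\<in>I. \<mu> l *\<^sub>R c l)"
    have "inner g (T (c l)) = \<mu> l * inner g (c l)" if "l \<in> I" for l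
      unfolding g_def inner_sum_left using Tc that by (simp add: sum_distrib_left mult_ac)
    then have "inner g (T e) = inner g g"
      by (subst (3) g_def) (simp add: ec T.sum inner_sum_right)
    then have "norm g * norm g \<le> norm g * norm (T e)"
      using norm_cauchy_schwarz[of g "T e"] by (simp add: power2_norm_eq_inner[symmetric] power2_eq_square)
    then have "norm g \<le> norm (T e)"
      by (cases "norm g = 0") (auto simp: mult_le_cancel_left_pos)
    then show ?thesis using L by (simp add: g_def)
  qed
  have Te_a: "norm (\<Sum>k\<in>K. \<kappa> k *\<^sub>R a k) \<le> L"
    using L(2) by (simp add: ea T.sum Ta)
  \<comment> \<open>Replacing \<open>t + \<kappa> k\<close> and \<open>t + \<mu> l\<close> by
    \<open>t\<close> bounds each of the two vectors in \<open>\<Phi>'\<close> by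
    \<open>L / (t * sqrt t)\<close>; \<open>4 * L / sqrt t\<close> is chosen because its derivative
    is minus twice this.\<close>
  have far: "\<Phi> s \<le> \<Phi> T + 4 * L / sqrt T" if "0 < T" "T \<le> s" for T s
  proof -
    have "\<Phi> s + 4 * L / sqrt s \<le> \<Phi> T + 4 * L / sqrt T"
    proof (rule DERIV_nonpos_imp_nonincreasing[OF that(2), where f = "\<lambda>t. \<Phi> t + 4 * L / sqrt t"])
      fix t assume "T \<le> t" "t \<le> s"
      then have t: "t > 0" using that by simp
      have A: "norm (\<Sum>k\<in>K. (\<kappa> k / (sqrt t * (t + \<kappa> k))) *\<^sub>R a k) \<le> L / (t * sqrt t)"
      proof -
        have "norm (\<Sum>k\<in>K. (\<kappa> k / (sqrt t * (t + \<kappa> k))) *\<^sub>R a k)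
           \<le> norm (\<Sum>k\<in>K. (\<kappa> k / (t * sqrt t)) *\<^sub>R a k)"
          using t \<kappa> by (intro norm_sum_orthogonal_le K a_orth)
            (auto simp: abs_mult less_imp_le intro!: divide_left_mono mult_pos_pos add_pos_pos)
        also have "(\<Sum>k\<in>K. (\<kappa> k / (t * sqrt t)) *\<^sub>R a k) = (1 / (t * sqrt t)) *\<^sub>R (\<Sum>k\<in>K. \<kappa> k *\<^sub>R a k)"
          by (simp add: scaleR_sum_right)
        also have "norm \<dots> \<le> L / (t * sqrt t)" using Te_a t by (simp add: divide_right_mono)
        finally show ?thesis .
      qed
      have C: "norm (\<Sum>l\<in>I. (\<mu> l / (sqrt t * (t + \<mu> l))) *\<^sub>R c l) \<le> L / (t * sqrt t)"
      proof -
        have "norm (\<Sum>l\<in>I. (\<mu> l / (sqrt t * (t + \<mu> l))) *\<^sub>R c l)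
           \<le> norm (\<Sum>l\<in>I. (\<mu> l / (t * sqrt t)) *\<^sub>R c l)"
          using t \<mu> by (intro norm_sum_orthogonal_le I c_orth)
            (auto simp: abs_mult less_imp_le intro!: divide_left_mono mult_pos_pos add_pos_pos)
        also have "(\<Sum>l\<in>I. (\<mu> l / (t * sqrt t)) *\<^sub>R c l) = (1 / (t * sqrt t)) *\<^sub>R (\<Sum>l\<in>I. \<mu> l *\<^sub>R c l)"
          by (simp add: scaleR_sum_right)
        also have "norm \<dots> \<le> L / (t * sqrt t)" using Te_c t by (simp add: divide_right_mono)
        finally show ?thesis .
      qed
      have "\<Phi>' t = inner z ((\<Sum>k\<in>K. (\<kappa> k / (sqrt t * (t + \<kappa> k))) *\<^sub>R a k)
          - (\<Sum>l\<in>I. (\<mu> l / (sqrt t * (t + \<mu> l))) *\<^sub>R c l))"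
        by (simp add: \<Phi>'_def inner_diff_right inner_sum_right mult_ac)
      also have "\<dots> \<le> norm z * norm ((\<Sum>k\<in>K. (\<kappa> k / (sqrt t * (t + \<kappa> k))) *\<^sub>R a k)
          - (\<Sum>l\<in>I. (\<mu> l / (sqrt t * (t + \<mu> l))) *\<^sub>R c l))"
        by (rule norm_cauchy_schwarz)
      also have "\<dots> \<le> norm ((\<Sum>k\<in>K. (\<kappa> k / (sqrt t * (t + \<kappa> k))) *\<^sub>R a k)
          - (\<Sum>l\<in>I. (\<mu> l / (sqrt t * (t + \<mu> l))) *\<^sub>R c l))"
        using z by (intro mult_left_le_one_le) auto
      also have "\<dots> \<le> L / (t * sqrt t) + L / (t * sqrt t)"
        by (rule order_trans[OF norm_triangle_ineq4]) (intro add_mono A C)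
      finally have "\<Phi>' t + (- 2 * L / (t * sqrt t)) \<le> 0" by simp
      moreover have "((\<lambda>t. \<Phi> t + 4 * L / sqrt t) has_real_derivative (\<Phi>' t + (- 2 * L / (t * sqrt t)))) (at t)"
      proof (rule DERIV_add[OF \<Phi>_deriv[OF t]])
        show "((\<lambda>t. 4 * L / sqrt t) has_real_derivative (- 2 * L / (t * sqrt t))) (at t)"
          using t by (auto intro!: derivative_eq_intros simp: field_simps)
      qed
      ultimately show "\<exists>y. ((\<lambda>t. \<Phi> t + 4 * L / sqrt t) has_real_derivative y) (at t) \<and> y \<le> 0" by blast
    qed
    moreover have "4 * L / sqrt s \<ge> 0" using L that by simp
    ultimately show ?thesis by linarith
  qed
  have "pi * norm y \<le> (\<epsilon> * D + T / \<epsilon>) / 2 + 4 * L / sqrt T" if "\<epsilon> > 0" "T > 0" for \<epsilon> T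
  proof -
    have "pi * norm y \<le> \<Phi> T + 4 * L / sqrt T"
      by (rule tendsto_upperbound[OF \<Phi>_lim])
        (use far that in \<open>auto intro!: eventually_at_top_linorderI\<close>)
    then show ?thesis using near[OF that] by linarith
  qed
  then have "(pi / 4 * norm y) ^ 4 \<le> L\<^sup>2 * D"
    using D L by (intro quartic_bound_of_trade_off) auto
  then show ?thesis by (simp add: y_def D_def)
qed

section \<open>The spectral theorem for Hermitian matrices\<close>

text \<open>Provides distributivity over sums, differences and real scalars for the matrix product;
  in finite dimension bilinearity already gives boundedness.\<close>

interpretation matrix_mult: bounded_bilinear "(**) :: complex^'n^'n \<Rightarrow> complex^'n^'n \<Rightarrow> complex^'n^'n"
  by (subst bilinear_conv_bounded_bilinear[symmetric])
    (auto simp: bilinear_def vec_eq_iff matrix_matrix_mult_def scaleR_sum_right sum.distrib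
      algebra_simps intro!: linearI)

lemma cadj_mult: "cadj (A ** B) = cadj B ** cadj A"
  by (simp add: cadj_def map_matrix_def transpose_def matrix_matrix_mult_def vec_eq_iff mult.commute)

lemma cadj_cadj [simp]: "cadj (cadj A) = A"
  by (simp add: cadj_def map_matrix_def transpose_def vec_eq_iff)

lemma cadj_mat_1 [simp]: "cadj (mat 1) = mat 1"
  by (simp add: cadj_def map_matrix_def transpose_def vec_eq_iff mat_def)

lemma linear_cadj: "linear cadj"
  by (rule linearI) (simp_all add: cadj_def map_matrix_def transpose_def vec_eq_iff)

lemma cadj_real_diag [simp]: "cadj (real_diag d) = real_diag d"
  by (simp add: cadj_def map_matrix_def transpose_def vec_eq_iff real_diag_def)

lemma trace_cadj: "trace (cadj A) = cnj (trace A)"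
  by (simp add: cadj_def map_matrix_def transpose_def trace_def)

lemma linear_trace: "linear (trace :: complex^'n^'n \<Rightarrow> complex)"
  by (rule linearI) (simp_all add: trace_def sum.distrib scaleR_sum_right)

text \<open>Connects the real inner product of the matrix type, in which the resolvent estimate is
  phrased, with the trace.\<close>

lemma inner_eq_trace: "inner X Y = Re (trace (cadj X ** Y))" for X Y :: "complex^'n^'n"
proof -
  have "inner X Y = (\<Sum>k\<in>UNIV. \<Sum>i\<in>UNIV. Re (cnj (X $ k $ i) * Y $ k $ i))"
    by (simp add: inner_vec_def inner_complex_def)
  also have "\<dots> = (\<Sum>i\<in>UNIV. \<Sum>k\<in>UNIV. Re (cnj (X $ k $ i) * Y $ k $ i))"
    by (rule sum.swap)
  finally show ?thesis
    by (simp add: trace_def cadj_def map_matrix_def transpose_def matrix_matrix_mult_def)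
qed

text \<open>A maximiser of the quadratic form on the unit sphere of \<open>S\<close>, which is
  compact, is an eigenvector: the first variation vanishes there.\<close>

lemma self_adjoint_has_eigenvector:
  fixes T :: "'a::euclidean_space \<Rightarrow> 'a"
  assumes "linear T" and sym: "\<And>x y. inner x (T y) = inner (T x) y"
    and S: "subspace S" "\<And>x. x \<in> S \<Longrightarrow> T x \<in> S" "x0 \<in> S" "x0 \<noteq> 0"
  obtains v c where "v \<in> S" "norm v = 1" "T v = c *\<^sub>R v"
proof -
  interpret T: linear T by fact
  have "compact (S \<inter> sphere 0 1)"
    using closed_subspace[OF S(1)] by (simp add: closed_Int_compact)
  moreover have "x0 /\<^sub>R norm x0 \<in> S \<inter> sphere 0 1"
    using S by (simp add: subspace_scale)
  moreover have "continuous_on (S \<inter> sphere 0 1) (\<lambda>x. inner x (T x))"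
    by (intro continuous_intros linear_continuous_on) (simp add: T.linear_axioms linear_conv_bounded_linear[symmetric])
  ultimately obtain v where "v \<in> S \<inter> sphere 0 1"
    and "\<forall>x\<in>S \<inter> sphere 0 1. inner x (T x) \<le> inner v (T v)"
    using continuous_attains_sup[of "S \<inter> sphere 0 1" "\<lambda>x. inner x (T x)"] by blast
  then have v: "v \<in> S" "norm v = 1"
    and max: "\<And>x. x \<in> S \<Longrightarrow> norm x = 1 \<Longrightarrow> inner x (T x) \<le> inner v (T v)"
    by auto
  define c where "c = inner v (T v)"
  have max': "inner x (T x) \<le> c * inner x x" if "x \<in> S" for x
  proof (cases "x = 0")
    case False
    have "inner (x /\<^sub>R norm x) (T (x /\<^sub>R norm x)) \<le> c"
      unfolding c_def using that False S(1) by (intro max) (auto simp: subspace_scale)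
    then have "inner x (T x) / (norm x)\<^sup>2 \<le> c"
      by (simp add: T.scale field_simps power2_eq_square)
    then show ?thesis using False by (simp add: power2_norm_eq_inner field_simps)
  qed (simp add: T.zero)
  \<comment> \<open>The residual \<open>w\<close> lies in \<open>S\<close>, so moving from
    \<open>v\<close> in direction \<open>w\<close> is admissible. Maximality bounds a gain of first
    order in \<open>s\<close> by a term of second order, which forces \<open>w = 0\<close>.\<close>
  define w where "w = T v - c *\<^sub>R v"
  have w: "w \<in> S" unfolding w_def using S v by (simp add: subspace_diff subspace_scale)
  define k where "k = c * inner w w - inner w (T w)"
  have vv: "inner v v = 1" using v by (simp add: power2_norm_eq_inner[symmetric])
  have ineq: "2 * s * inner w w \<le> s\<^sup>2 * k" for s
  proof -
    have "v + s *\<^sub>R w \<in> S" using v w S(1) by (simp add: subspace_add subspace_scale)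
    from max'[OF this] have le: "inner (v + s *\<^sub>R w) (T v + s *\<^sub>R T w) \<le> c * inner (v + s *\<^sub>R w) (v + s *\<^sub>R w)"
      by (simp add: T.add T.scale)
    have lhs: "inner (v + s *\<^sub>R w) (T v + s *\<^sub>R T w) = c + 2 * s * inner w (T v) + s\<^sup>2 * inner w (T w)"
      using sym[of v w] by (simp add: inner_add_left inner_add_right c_def power2_eq_square
          inner_commute[of w "T v"] algebra_simps)
    have rhs: "inner (v + s *\<^sub>R w) (v + s *\<^sub>R w) = 1 + 2 * s * inner w v + s\<^sup>2 * inner w w"
      by (simp add: inner_add_left inner_add_right vv power2_eq_square inner_commute[of v w] algebra_simps)
    have wTv: "inner w (T v) = inner w w + c * inner w v"
    proof -
      have "T v = w + c *\<^sub>R v" by (simp add: w_def)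
      then show ?thesis by (simp add: inner_add_right)
    qed
    from le show ?thesis unfolding lhs rhs wTv by (simp add: k_def algebra_simps)
  qed
  have "inner w w \<le> 0"
  proof (rule ccontr)
    assume "\<not> inner w w \<le> 0"
    then have q: "inner w w > 0" by linarith
    \<comment> \<open>Small enough that \<open>s * k\<close> stays below \<open>inner w w\<close>;
      the added 1 covers \<open>k = 0\<close>.\<close>
    define s where "s = inner w w / (\<bar>k\<bar> + 1)"
    have s: "s > 0" using q by (simp add: s_def)
    have "2 * inner w w \<le> s * k" using ineq[of s] s by (simp add: power2_eq_square)
    also have "\<dots> \<le> s * \<bar>k\<bar>" using s by simp
    also have "\<dots> \<le> s * (\<bar>k\<bar> + 1)" using s by simp
    also have "\<dots> = inner w w" by (simp add: s_def)
    finally show False using q by simp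
  qed
  then have "w = 0" using inner_gt_zero_iff[of w] by linarith
  then have "T v = c *\<^sub>R v" by (simp add: w_def)
  with v that show ?thesis by blast
qed

section \<open>The complex inner product and orthonormal eigenvectors\<close>

text \<open>Conjugate-linear in the first argument. Unitarity needs complex orthogonality, of which
  \<open>inner\<close> records only the real part.\<close>

definition cdot :: "complex^'n \<Rightarrow> complex^'n \<Rightarrow> complex" where
  "cdot x y = (\<Sum>i\<in>UNIV. cnj (x $ i) * y $ i)"

lemma Re_cdot: "Re (cdot x y) = inner x y"
  by (simp add: cdot_def inner_vec_def inner_complex_def)

lemma cdot_add_right: "cdot x (y + z) = cdot x y + cdot x z"
  and cdot_add_left: "cdot (x + y) z = cdot x z + cdot y z"
  and cdot_diff_right: "cdot x (y - z) = cdot x y - cdot x z"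
  and cdot_scale_right: "cdot x (c *s y) = c * cdot x y"
  and cdot_scale_left: "cdot (c *s x) y = cnj c * cdot x y"
  and cdot_scaleR_right: "cdot x (r *\<^sub>R y) = of_real r * cdot x y"
  and cdot_scaleR_left: "cdot (r *\<^sub>R x) y = of_real r * cdot x y"
  by (simp_all add: cdot_def algebra_simps sum.distrib sum_subtractf sum_distrib_left scaleR_conv_of_real[where 'a = complex])

lemma cnj_cdot: "cnj (cdot x y) = cdot y x"
  by (simp add: cdot_def mult.commute)

lemma cdot_self: "cdot x x = of_real ((norm x)\<^sup>2)"
proof -
  have "Im (cdot x x) = 0" by (simp add: cdot_def algebra_simps)
  then show ?thesis by (simp add: complex_eq_iff Re_cdot power2_norm_eq_inner)
qed

lemma cdot_matrix_vector: "cdot x (A *v y) = cdot (cadj A *v x) y"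
proof -
  have "cdot x (A *v y) = (\<Sum>i\<in>UNIV. \<Sum>j\<in>UNIV. cnj (x $ i) * (A $ i $ j * y $ j))"
    by (simp add: cdot_def matrix_vector_mult_def sum_distrib_left)
  also have "\<dots> = (\<Sum>j\<in>UNIV. \<Sum>i\<in>UNIV. cnj (x $ i) * (A $ i $ j * y $ j))"
    by (rule sum.swap)
  finally show ?thesis
    by (simp add: cdot_def matrix_vector_mult_def sum_distrib_left sum_distrib_right cadj_def map_matrix_def transpose_def mult_ac)
qed

lemma cdot_axis: "cdot (axis i 1) (A *v axis j 1) = A $ i $ j" for A :: "complex^'n^'m"
proof -
  have "cdot (axis i 1) x = x $ i" for x :: "complex^'m"
    by (simp add: cdot_def axis_def if_distrib[of cnj] if_distrib[of "\<lambda>z. z * _"] cong: if_cong)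
  then show ?thesis
    by (simp add: matrix_vector_mult_def axis_def if_distrib[of "\<lambda>z. _ * z"] cong: if_cong)
qed

text \<open>A square matrix whose rows are the conjugated \<open>f i\<close>, with row
  \<open>k\<close> equal to 0, is singular; a kernel vector is the one sought.\<close>

lemma orthogonal_vector_exists:
  fixes f :: "'n \<Rightarrow> complex^'n"
  assumes "k \<notin> J"
  obtains x where "x \<noteq> 0" "\<forall>i\<in>J. cdot (f i) x = 0"
proof -
  define B :: "complex^'n^'n" where "B = (\<chi> i j. if i \<in> J then cnj (f i $ j) else 0)"
  have "row k B = 0" using assms by (simp add: B_def row_def vec_eq_iff)
  then have "det B = 0" by (rule det_zero_row)
  then have "\<not> invertible B" by (simp add: invertible_det_nz)
  then obtain x where x: "x \<noteq> 0" "B *v x = 0"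
    unfolding invertible_left_inverse matrix_left_invertible_ker by blast
  moreover have "cdot (f i) x = 0" if "i \<in> J" for i
  proof -
    have "cdot (f i) x = (B *v x) $ i"
      using that by (simp add: B_def cdot_def matrix_vector_mult_def)
    then show ?thesis using x by simp
  qed
  ultimately show ?thesis using that by blast
qed

text \<open>Induction on the index set: the orthogonal complement of the eigenvectors found so far
  is nonzero and invariant under \<open>A\<close>, hence contains a further one. For the full index
  set this is an orthonormal eigenbasis.\<close>

lemma hermitian_orthonormal_eigenvectors:
  fixes A :: "complex^'n^'n"
  assumes A: "cadj A = A" and "finite J"
  shows "\<exists>f d. (\<forall>i\<in>J. \<forall>j\<in>J. cdot (f i) (f j) = (if i = j then 1 else 0)) \<and>
    (\<forall>i\<in>J. A *v f i = (d i :: real) *\<^sub>R f (i :: 'n))"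
  using \<open>finite J\<close>
proof (induction J rule: finite_induct)
  case (insert k J)
  from insert.IH obtain f d
    where fd: "(\<forall>i\<in>J. \<forall>j\<in>J. cdot (f i) (f j) = (if i = j then 1 else 0)) \<and>
      (\<forall>i\<in>J. A *v f i = (d i :: real) *\<^sub>R f i)" by (elim exE)
  have f: "cdot (f i) (f j) = (if i = j then 1 else 0)" if "i \<in> J" "j \<in> J" for i j
    using fd that by (simp only: Ball_def)
  have d: "A *v f i = d i *\<^sub>R f i" if "i \<in> J" for i
    using fd that by (simp only: Ball_def)
  define S where "S = {x. \<forall>i\<in>J. cdot (f i) x = 0}"
  obtain x0 where "x0 \<noteq> 0" "\<forall>i\<in>J. cdot (f i) x0 = 0"
    by (rule orthogonal_vector_exists[OF insert.hyps(2), of f])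
  then have x0: "x0 \<in> S" "x0 \<noteq> 0" by (auto simp: S_def)
  have S: "subspace S"
    by (auto simp: subspace_def S_def cdot_add_right cdot_scaleR_right) (simp add: cdot_def)
  have AS: "A *v x \<in> S" if "x \<in> S" for x
    using that by (simp add: S_def cdot_matrix_vector A d cdot_scaleR_left)
  have sym: "inner x (A *v y) = inner (A *v x) y" for x y
    unfolding Re_cdot[symmetric] by (simp add: cdot_matrix_vector A)
  obtain v c where v: "v \<in> S" "norm v = 1" "A *v v = c *\<^sub>R v"
    by (rule self_adjoint_has_eigenvector[OF matrix_vector_mul_linear[of A] sym S AS x0])
  have fv: "cdot (f i) v = 0" "cdot v (f i) = 0" if "i \<in> J" for i
    using v(1) that cnj_cdot[of "f i" v] by (auto simp: S_def)
  have vv: "cdot v v = 1" by (simp add: cdot_self v(2))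
  show ?case
    by (intro exI[of _ "f(k := v)"] exI[of _ "d(k := c)"])
      (use insert.hyps f d v(3) fv vv in auto)
qed simp

theorem hermitian_diagonalizable:
  fixes A :: "complex^'n^'n"
  assumes "cadj A = A"
  obtains U d where "unitary_matrix U" "A = U ** real_diag d ** cadj U"
proof -
  obtain f d where f: "\<And>i j. cdot (f i) (f j) = (if i = j then 1 else 0)"
    and d: "\<And>i. A *v f i = (d i :: real) *\<^sub>R f (i :: 'n)"
    using hermitian_orthonormal_eigenvectors[OF assms finite[of UNIV]] by auto
  define U :: "complex^'n^'n" where "U = (\<chi> i j. f j $ i)"
  have "cadj U ** U = mat 1"
    using f by (simp add: U_def cadj_def map_matrix_def transpose_def matrix_matrix_mult_def
        vec_eq_iff mat_def cdot_def)
  then have U: "unitary_matrix U"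
    by (simp add: unitary_matrix_def matrix_left_right_inverse)
  have "(A ** U) $ i $ j = (U ** real_diag d) $ i $ j" for i j
  proof -
    have "(A ** U) $ i $ j = (A *v f j) $ i"
      by (simp add: U_def matrix_matrix_mult_def matrix_vector_mult_def)
    then show ?thesis by (simp add: d real_diag_mult_right U_def scaleR_conv_of_real[where 'a = complex])
  qed
  then have "A ** U = U ** real_diag d" by (simp add: vec_eq_iff)
  then have "A = U ** real_diag d ** cadj U"
    using U by (metis matrix_mul_assoc matrix_mul_rid unitary_matrix_def)
  with U that show ?thesis by blast
qed

section \<open>Functional calculus in star subalgebras\<close>

text \<open>One diagonalization of \<open>A\<close> serves every function by
  \<open>mat_fun_eqI\<close>, so each law reduces to real diagonal matrices.\<close>

lemma mat_fun_laws:
  assumes "cadj A = A"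
  shows mat_fun_mult: "mat_fun f A ** mat_fun g A = mat_fun (\<lambda>x. f x * g x) A"
    and mat_fun_add: "mat_fun f A + mat_fun g A = mat_fun (\<lambda>x. f x + g x) A"
    and mat_fun_const: "mat_fun (\<lambda>_. c) A = c *\<^sub>R mat 1"
    and mat_fun_ident: "mat_fun (\<lambda>x. x) A = A"
    and cadj_mat_fun: "cadj (mat_fun f A) = mat_fun f A"
    and mat_fun_mat_fun: "mat_fun f (mat_fun g A) = mat_fun (\<lambda>x. f (g x)) A"
proof -
  obtain U d where U: "unitary_matrix U" and A: "A = U ** real_diag d ** cadj U"
    by (rule hermitian_diagonalizable[OF assms])
  have UU: "cadj U ** U = mat 1" "U ** cadj U = mat 1"
    using U by (auto simp: unitary_matrix_def)
  note eq = mat_fun_eqI[OF U A]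
  have conj_mult: "(U ** X ** cadj U) ** (U ** Y ** cadj U) = U ** (X ** Y) ** cadj U" for X Y
  proof -
    have "(U ** X ** cadj U) ** (U ** Y ** cadj U) = U ** X ** (cadj U ** U) ** Y ** cadj U"
      by (simp only: matrix_mul_assoc)
    then show ?thesis by (simp add: UU matrix_mul_assoc)
  qed
  have "real_diag (f \<circ> d) ** real_diag (g \<circ> d) = real_diag ((\<lambda>x. f x * g x) \<circ> d)"
    by (simp add: vec_eq_iff real_diag_mult_left) (simp add: real_diag_def)
  then show "mat_fun f A ** mat_fun g A = mat_fun (\<lambda>x. f x * g x) A"
    unfolding eq conj_mult by simp
  have "real_diag (f \<circ> d) + real_diag (g \<circ> d) = real_diag ((\<lambda>x. f x + g x) \<circ> d)"
    by (simp add: vec_eq_iff real_diag_def)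
  then show "mat_fun f A + mat_fun g A = mat_fun (\<lambda>x. f x + g x) A"
    unfolding eq by (simp add: matrix_mult.add_left[symmetric] matrix_mult.add_right[symmetric])
  have "real_diag ((\<lambda>_. c) \<circ> d) = c *\<^sub>R mat 1"
    by (simp add: vec_eq_iff real_diag_def mat_def scaleR_conv_of_real[where 'a = complex])
  then show "mat_fun (\<lambda>_. c) A = c *\<^sub>R mat 1"
    unfolding eq by (simp add: matrix_mult.scaleR_left matrix_mult.scaleR_right UU)
  show "mat_fun (\<lambda>x. x) A = A"
    unfolding eq by (simp add: A comp_def)
  show "cadj (mat_fun f A) = mat_fun f A"
    unfolding eq by (simp add: cadj_mult matrix_mul_assoc)
  show "mat_fun f (mat_fun g A) = mat_fun (\<lambda>x. f (g x)) A"
    by (subst mat_fun_eqI[OF U eq[of g], of f]) (simp add: eq comp_def)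
qed

section \<open>Spectral projections\<close>

text \<open>The spectral projection as functional calculus of an indicator; for Hermitian
  \<open>A\<close> it is 0 when \<open>x\<close> is not an eigenvalue, so laws about it need no side
  condition on \<open>x\<close>.\<close>

definition eigenproj :: "complex^'n^'n \<Rightarrow> real \<Rightarrow> complex^'n^'n" where
  "eigenproj A x = mat_fun (\<lambda>y. of_bool (y = x)) A"

definition eigvals :: "complex^'n^'n \<Rightarrow> real set" where
  "eigvals A = {x. eigenproj A x \<noteq> 0}"

lemma cadj_eigenproj: "cadj A = A \<Longrightarrow> cadj (eigenproj A x) = eigenproj A x"
  by (simp add: eigenproj_def cadj_mat_fun)

lemma mat_fun_zero: "cadj A = A \<Longrightarrow> mat_fun (\<lambda>_. 0) A = 0"
  by (simp add: mat_fun_const)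

lemma eigenproj_mult:
  assumes "cadj A = A"
  shows "eigenproj A x ** eigenproj A y = (if x = y then eigenproj A x else 0)"
proof -
  have "(\<lambda>z. of_bool (z = x) * of_bool (z = y) :: real)
     = (if x = y then (\<lambda>z. of_bool (z = x)) else (\<lambda>_. 0))" by auto
  then show ?thesis
    using assms by (simp add: eigenproj_def mat_fun_mult mat_fun_zero)
qed

text \<open>Grouping equal entries of a diagonalization by value gives a sum that no longer refers
  to the chosen unitary.\<close>

lemma spectral_expansion:
  assumes "cadj A = A"
  shows finite_eigvals: "finite (eigvals A)"
    and mat_fun_eq_sum: "mat_fun f A = (\<Sum>x\<in>eigvals A. f x *\<^sub>R eigenproj A x)"
proof -
  obtain U d where U: "unitary_matrix U" and A: "A = U ** real_diag d ** cadj U"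
    by (rule hermitian_diagonalizable[OF assms])
  note eq = mat_fun_eqI[OF U A]
  have "eigenproj A x = 0" if "x \<notin> range d" for x
  proof -
    have "real_diag ((\<lambda>y. of_bool (y = x)) \<circ> d) = 0"
      using that by (auto simp: real_diag_def vec_eq_iff)
    then show ?thesis by (simp add: eigenproj_def eq)
  qed
  then have sub: "eigvals A \<subseteq> range d" by (auto simp: eigvals_def)
  then show "finite (eigvals A)" by (rule finite_subset) simp
  have delta: "(\<Sum>x\<in>range d. f x *\<^sub>R complex_of_real (of_bool (d i = x))) = of_real (f (d i))" for i
    by (simp add: of_bool_def if_distrib[of of_real] if_distrib[of "\<lambda>z. _ * z"] scaleR_conv_of_real[where 'a = complex]
        cong: if_cong)
  have "real_diag (f \<circ> d) = (\<Sum>x\<in>range d. f x *\<^sub>R real_diag ((\<lambda>y. of_bool (y = x)) \<circ> d))"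
    by (simp add: real_diag_def vec_eq_iff delta)
  then have "mat_fun f A = (\<Sum>x\<in>range d. f x *\<^sub>R eigenproj A x)"
    by (simp add: eq eigenproj_def matrix_mult.sum_left matrix_mult.sum_right
        matrix_mult.scaleR_left matrix_mult.scaleR_right)
  also have "\<dots> = (\<Sum>x\<in>eigvals A. f x *\<^sub>R eigenproj A x)"
    using sub by (intro sum.mono_neutral_right) (auto simp: eigvals_def)
  finally show "mat_fun f A = (\<Sum>x\<in>eigvals A. f x *\<^sub>R eigenproj A x)" .
qed

lemma mat_fun_cong:
  assumes "cadj A = A" "\<And>x. x \<in> eigvals A \<Longrightarrow> f x = g x"
  shows "mat_fun f A = mat_fun g A"
  using assms by (simp add: mat_fun_eq_sum)

lemma sum_eigenproj:
  assumes "cadj A = A"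
  shows "(\<Sum>x\<in>eigvals A. eigenproj A x) = mat 1"
  using mat_fun_eq_sum[OF assms, of "\<lambda>_. 1"] mat_fun_const[OF assms, of 1] by simp

lemma mat_fun_mult_eigenproj:
  assumes "cadj A = A"
  shows "mat_fun f A ** eigenproj A x = f x *\<^sub>R eigenproj A x"
    and eigenproj_mult_mat_fun: "eigenproj A x ** mat_fun f A = f x *\<^sub>R eigenproj A x"
proof -
  have eq: "(\<lambda>y. f y * of_bool (y = x)) = (\<lambda>y. f x * of_bool (y = x))" by auto
  have "f x *\<^sub>R eigenproj A x = mat_fun (\<lambda>_. f x) A ** eigenproj A x"
    by (simp add: mat_fun_const[OF assms] matrix_mult.scaleR_left)
  also have "\<dots> = mat_fun (\<lambda>y. f x * of_bool (y = x)) A"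
    unfolding eigenproj_def mat_fun_mult[OF assms] ..
  finally have *: "f x *\<^sub>R eigenproj A x = mat_fun (\<lambda>y. f y * of_bool (y = x)) A"
    by (simp only: eq)
  show "mat_fun f A ** eigenproj A x = f x *\<^sub>R eigenproj A x"
    unfolding * unfolding eigenproj_def mat_fun_mult[OF assms] ..
  show "eigenproj A x ** mat_fun f A = f x *\<^sub>R eigenproj A x"
    unfolding * unfolding eigenproj_def mat_fun_mult[OF assms] by (simp only: mult.commute)
qed

lemma mult_eigenproj:
  assumes "cadj A = A"
  shows "A ** eigenproj A x = x *\<^sub>R eigenproj A x" "eigenproj A x ** A = x *\<^sub>R eigenproj A x"
  using mat_fun_mult_eigenproj[OF assms, where f = "\<lambda>x. x"] eigenproj_mult_mat_fun[OF assms, where f = "\<lambda>x. x"]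
  by (simp_all add: mat_fun_ident[OF assms])

lemma star_subalgebraD:
  assumes "star_subalgebra S"
  shows "mat 1 \<in> S"
    and "A \<in> S \<Longrightarrow> B \<in> S \<Longrightarrow> A + B \<in> S"
    and "A \<in> S \<Longrightarrow> B \<in> S \<Longrightarrow> A ** B \<in> S"
    and "A \<in> S \<Longrightarrow> map_matrix ((*) c) A \<in> S"
    and "A \<in> S \<Longrightarrow> cadj A \<in> S"
  using assms by (auto simp: star_subalgebra_def)

lemma star_subalgebra_subspace:
  assumes "star_subalgebra S"
  shows "subspace S"
proof -
  have scale: "c *\<^sub>R A \<in> S" if "A \<in> S" for c A
  proof -
    have "c *\<^sub>R A = map_matrix ((*) (of_real c)) A"
      by (simp add: map_matrix_def vec_eq_iff scaleR_conv_of_real[where 'a = complex])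
    then show ?thesis using star_subalgebraD(4)[OF assms that] by simp
  qed
  moreover have "0 \<in> S" using scale[OF star_subalgebraD(1)[OF assms], of 0] by simp
  ultimately show ?thesis using star_subalgebraD(2)[OF assms] by (auto simp: subspace_def)
qed

text \<open>The projection onto an eigenspace is a Lagrange interpolation polynomial in the matrix.\<close>

lemma eigenproj_mem:
  assumes S: "star_subalgebra S" "A \<in> S" and A: "cadj A = A"
  shows "eigenproj A x \<in> S"
proof -
  have scale: "c *\<^sub>R B \<in> S" if "B \<in> S" for c B
    using star_subalgebra_subspace[OF S(1)] that by (simp add: subspace_scale)
  \<comment> \<open>Every factor is 1 at \<open>y = x\<close>, provided \<open>x\<close> is not in
    \<open>Z\<close>, and one factor vanishes at each \<open>y\<close> in \<open>Z\<close>.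
    Membership in \<open>S\<close> is proved for all finite \<open>Z\<close>; a factor with
    \<open>z = x\<close> is 0 by the convention for division by zero.\<close>
  define p where "p Z y = (\<Prod>z\<in>Z. (y - z) / (x - z))" for Z y
  have "mat_fun (p Z) A \<in> S" if "finite Z" for Z
    using that
  proof (induction Z rule: finite_induct)
    case empty
    show ?case
      using scale[OF star_subalgebraD(1)[OF S(1)], of 1] by (simp add: p_def mat_fun_const[OF A])
  next
    case (insert z Z)
    define q where "q y = y / (x - z) + - z / (x - z)" for y
    have "mat_fun q A = mat_fun (\<lambda>y. y) A ** mat_fun (\<lambda>_. 1 / (x - z)) A + mat_fun (\<lambda>_. - z / (x - z)) A"
      by (simp add: mat_fun_mult[OF A] mat_fun_add[OF A] q_def[abs_def])
    also have "\<dots> \<in> S"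
      by (simp only: mat_fun_const[OF A] mat_fun_ident[OF A])
        (intro star_subalgebraD(2,3)[OF S(1)] scale star_subalgebraD(1)[OF S(1)] S(2))
    finally have "mat_fun q A ** mat_fun (p Z) A \<in> S"
      using insert.IH star_subalgebraD(3)[OF S(1)] by blast
    moreover have "p (insert z Z) = (\<lambda>y. q y * p Z y)"
      using insert.hyps by (auto simp: p_def q_def diff_divide_distrib)
    ultimately show ?case by (simp add: mat_fun_mult[OF A])
  qed
  then have "mat_fun (p (eigvals A - {x})) A \<in> S"
    using finite_eigvals[OF A] by simp
  moreover have "mat_fun (p (eigvals A - {x})) A = eigenproj A x"
    unfolding eigenproj_def
  proof (rule mat_fun_cong[OF A])
    fix y assume "y \<in> eigvals A"
    show "p (eigvals A - {x}) y = of_bool (y = x)"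
    proof (cases "y = x")
      case True
      then show ?thesis by (auto simp: p_def intro!: prod.neutral)
    next
      case False
      then have "y \<in> eigvals A - {x}" using \<open>y \<in> eigvals A\<close> by simp
      then show ?thesis
        using False finite_eigvals[OF A] by (auto simp: p_def intro!: prod_zero bexI[of _ y])
    qed
  qed
  ultimately show ?thesis by simp
qed

lemma mat_fun_mem:
  assumes "star_subalgebra S" "A \<in> S" "cadj A = A"
  shows "mat_fun f A \<in> S"
  unfolding mat_fun_eq_sum[OF assms(3)]
  using star_subalgebra_subspace[OF assms(1)] eigenproj_mem[OF assms]
  by (intro subspace_sum subspace_scale) auto

section \<open>Positive definite matrices\<close>

text \<open>Phrased through the spectrum because logarithms and powers are evaluated exactly on
  \<open>eigvals A\<close>.\<close>

definition positive_definite :: "complex^'n^'n \<Rightarrow> bool" where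
  "positive_definite A \<longleftrightarrow> cadj A = A \<and> (\<forall>x\<in>eigvals A. 0 < x)"

text \<open>The quadratic form of \<open>A\<close> is real, so that of \<open>A - cadj A\<close>
  vanishes, and polarization makes the difference itself vanish.\<close>

lemma psd_hermitian:
  assumes "psd A"
  shows "cadj A = A"
proof -
  define B where "B = A - cadj A"
  have real: "cdot v (A *v v) \<in> \<real>" for v
    using assms nonneg_Reals_subset_Reals by (auto simp: psd_def cdot_def)
  have B0: "cdot v (B *v v) = 0" for v
  proof -
    have "cdot v (cadj A *v v) = cnj (cdot v (A *v v))"
      by (simp add: cdot_matrix_vector cnj_cdot)
    then show ?thesis using real[of v]
      by (simp add: B_def matrix_vector_mult_diff_rdistrib cdot_diff_right Reals_cnj_iff)
  qed
  have "B $ i $ j = 0" for i j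
  proof -
    define x y where "x = (axis i 1 :: complex^'a)" and "y = (axis j 1 :: complex^'a)"
    have "c * cdot x (B *v y) + cnj c * cdot y (B *v x) = 0" for c
    proof -
      have "cdot (x + c *s y) (B *v (x + c *s y)) = cdot x (B *v x) + c * cnj c * cdot y (B *v y)
        + (c * cdot x (B *v y) + cnj c * cdot y (B *v x))"
        by (simp add: matrix_vector_right_distrib vector_scalar_commute cdot_add_left cdot_add_right
            cdot_scale_left cdot_scale_right algebra_simps)
      then show ?thesis by (simp add: B0)
    qed
    \<comment> \<open>\<open>c = 1\<close> makes the sum of the two off-diagonal terms vanish,
      \<open>c = \<i>\<close> their difference.\<close>
    from this[of 1] this[of \<i>] have "cdot x (B *v y) = 0" by (simp add: algebra_simps)
    then show ?thesis by (simp add: x_def y_def cdot_axis)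
  qed
  then have "B = 0" by (simp add: vec_eq_iff)
  then show ?thesis by (simp add: B_def)
qed

text \<open>Any nonzero vector in the range of a spectral projection is an eigenvector: positivity
  gives \<open>0 \<le> x\<close>, and invertibility excludes 0.\<close>

lemma psd_invertible_positive_definite:
  assumes "psd A" "invertible A"
  shows "positive_definite A"
proof -
  have A: "cadj A = A" by (rule psd_hermitian[OF assms(1)])
  have "0 < x" if "x \<in> eigvals A" for x
  proof -
    have "eigenproj A x \<noteq> 0" using that by (simp add: eigvals_def)
    then obtain v where v: "eigenproj A x *v v \<noteq> 0"
      by (metis matrix_eq matrix_vector_mult_0)
    define w where "w = eigenproj A x *v v"
    have w: "w \<noteq> 0" using v by (simp add: w_def)
    have Aw: "A *v w = x *\<^sub>R w"
      by (simp add: w_def matrix_vector_mul_assoc mult_eigenproj[OF A])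
        (simp add: matrix_vector_mult_def vec_eq_iff scaleR_sum_right)
    have "x \<noteq> 0"
      using w Aw assms(2) by (auto simp: invertible_left_inverse matrix_left_invertible_ker)
    moreover have "cdot w (A *v w) \<in> \<real>\<^sub>\<ge>\<^sub>0"
      using assms(1) by (simp add: psd_def cdot_def)
    then have "0 \<le> x * (norm w)\<^sup>2"
      by (simp add: Aw cdot_scaleR_right cdot_self flip: of_real_mult of_real_power)
    then have "0 \<le> x" using w by (simp add: zero_le_mult_iff)
    ultimately show ?thesis by simp
  qed
  then show ?thesis using A by (simp add: positive_definite_def)
qed

section \<open>The tracial conditional expectation\<close>

text \<open>Two candidates differ by an element of \<open>N\<close> that is orthogonal to
  itself.\<close>

lemma tracial_cond_exp_unique:
  assumes N: "star_subalgebra N" and Y: "Y \<in> N" "\<And>Z. Z \<in> N \<Longrightarrow> hs_inner Z (X - Y) = 0"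
  shows "tracial_cond_exp N X = Y"
  unfolding tracial_cond_exp_def
proof (rule the_equality)
  fix Y' assume Y': "Y' \<in> N \<and> (\<forall>Z\<in>N. hs_inner Z (X - Y') = 0)"
  have mem: "Y - Y' \<in> N" using star_subalgebra_subspace[OF N] Y Y' by (simp add: subspace_diff)
  have "hs_inner (Y - Y') (Y - Y') = hs_inner (Y - Y') (X - Y') - hs_inner (Y - Y') (X - Y)"
    by (simp add: hs_inner_def trace_sub[symmetric] matrix_mult.diff_right[symmetric])
  then have "hs_inner (Y - Y') (Y - Y') = 0" using mem Y Y' by simp
  then have "norm (Y - Y') = 0" unfolding norm_eq_hs_inner by simp
  then show "Y' = Y" by simp
qed (use Y in auto)

text \<open>Existence comes from the real orthogonal decomposition. Real orthogonality upgrades to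
  complex orthogonality because \<open>N\<close> is closed under multiplication by
  \<open>\<i>\<close>.\<close>

lemma tracial_cond_exp:
  assumes N: "star_subalgebra N"
  shows tracial_cond_exp_mem: "tracial_cond_exp N X \<in> N"
    and tracial_cond_exp_orthogonal: "Z \<in> N \<Longrightarrow> hs_inner Z (X - tracial_cond_exp N X) = 0"
proof -
  have span: "span N = N" using star_subalgebra_subspace[OF N] by (simp add: span_eq_iff)
  have "\<exists>Y W. Y \<in> N \<and> (\<forall>Z\<in>N. orthogonal W Z) \<and> X = Y + W"
    by (rule orthogonal_subspace_decomp_exists[of N X, unfolded span]) blast
  then obtain Y W where Y: "Y \<in> N" and W: "\<And>Z. Z \<in> N \<Longrightarrow> orthogonal W Z" and X: "X = Y + W"
    by blast
  have Re0: "Re (hs_inner Z W) = 0" if "Z \<in> N" for Z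
    using W[OF that] unfolding orthogonal_commute[of W]
    by (simp add: orthogonal_def inner_eq_trace hs_inner_def)
  have "hs_inner Z W = 0" if "Z \<in> N" for Z
  proof -
    have "hs_inner (map_matrix ((*) \<i>) Z) W = - \<i> * hs_inner Z W"
      by (simp add: hs_inner_def trace_def cadj_def map_matrix_def transpose_def
          matrix_matrix_mult_def sum_distrib_left mult.assoc sum_negf)
    then have "Im (hs_inner Z W) = 0"
      using Re0[OF star_subalgebraD(4)[OF N that], of \<i>] by simp
    then show ?thesis using Re0[OF that] by (simp add: complex_eq_iff)
  qed
  then have orth: "hs_inner Z (X - Y) = 0" if "Z \<in> N" for Z using X that by simp
  have "tracial_cond_exp N X = Y" using tracial_cond_exp_unique[OF N Y orth] by blast
  then show "tracial_cond_exp N X \<in> N" "Z \<in> N \<Longrightarrow> hs_inner Z (X - tracial_cond_exp N X) = 0"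
    using Y orth by auto
qed

lemma trace_tracial_cond_exp:
  assumes N: "star_subalgebra N" and "Z \<in> N"
  shows "trace (Z ** tracial_cond_exp N X) = trace (Z ** X)"
  using tracial_cond_exp_orthogonal[OF N star_subalgebraD(5)[OF assms], of X]
  by (simp add: hs_inner_def matrix_mult.diff_right trace_sub)

lemma cadj_tracial_cond_exp:
  assumes N: "star_subalgebra N" and X: "cadj X = X"
  shows "cadj (tracial_cond_exp N X) = tracial_cond_exp N X"
proof (rule sym, rule tracial_cond_exp_unique[OF N])
  show "cadj (tracial_cond_exp N X) \<in> N"
    by (intro star_subalgebraD(5)[OF N] tracial_cond_exp_mem[OF N])
  fix Z assume Z: "Z \<in> N"
  have "hs_inner Z (X - cadj (tracial_cond_exp N X))
      = trace (cadj (X - tracial_cond_exp N X) ** cadj Z)"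
    unfolding hs_inner_def linear_diff[OF linear_cadj] X cadj_cadj by (rule trace_mul_sym)
  also have "\<dots> = cnj (hs_inner (cadj Z) (X - tracial_cond_exp N X))"
    by (simp add: hs_inner_def cadj_mult[symmetric] trace_cadj)
  also have "\<dots> = 0"
    using tracial_cond_exp_orthogonal[OF N star_subalgebraD(5)[OF N Z]] by simp
  finally show "hs_inner Z (X - cadj (tracial_cond_exp N X)) = 0" .
qed

lemma inner_matrix_mult_left: "inner (A ** X) Y = inner X (cadj A ** Y)"
  for A X Y :: "complex^'n^'n"
  by (simp add: inner_eq_trace cadj_mult matrix_mul_assoc)

lemma inner_matrix_mult_right: "inner (X ** A) Y = inner X (Y ** cadj A)"
  for A X Y :: "complex^'n^'n"
proof -
  have "trace (cadj A ** (cadj X ** Y)) = trace ((cadj X ** Y) ** cadj A)" by (rule trace_mul_sym)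
  then show ?thesis by (simp add: inner_eq_trace cadj_mult matrix_mul_assoc)
qed

text \<open>Both factors are orthogonal projections, so cyclicity of the trace produces a
  square.\<close>

lemma trace_eigenproj_mult:
  assumes A: "cadj A = A" and Q: "cadj Q = Q" "Q ** Q = Q"
  shows "Re (trace (eigenproj A x ** Q)) = (norm (eigenproj A x ** Q))\<^sup>2"
proof -
  have "(norm (eigenproj A x ** Q))\<^sup>2 = inner (eigenproj A x ** Q) (eigenproj A x ** Q)"
    by (simp add: power2_norm_eq_inner)
  also have "\<dots> = inner (eigenproj A x) (eigenproj A x ** Q)"
    by (simp add: inner_matrix_mult_right Q matrix_mul_assoc[symmetric])
  also have "\<dots> = Re (trace (eigenproj A x ** Q))"
    by (simp add: inner_eq_trace cadj_eigenproj[OF A] matrix_mul_assoc eigenproj_mult[OF A])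
  finally show ?thesis by simp
qed

text \<open>All terms of the spectral expansion are nonnegative, and they cannot all vanish because
  the spectral projections of \<open>A\<close> sum to the identity.\<close>

lemma trace_mult_projection_pos:
  assumes A: "positive_definite A" and Q: "cadj Q = Q" "Q ** Q = Q" "Q \<noteq> 0"
  shows "0 < Re (trace (A ** Q))"
proof -
  have h: "cadj A = A" using A by (simp add: positive_definite_def)
  have nn: "0 \<le> x * (norm (eigenproj A x ** Q))\<^sup>2" if "x \<in> eigvals A" for x
    using A that by (simp add: positive_definite_def less_imp_le)
  have eq: "Re (trace (A ** Q)) = (\<Sum>x\<in>eigvals A. x * (norm (eigenproj A x ** Q))\<^sup>2)"
    using arg_cong[OF mat_fun_eq_sum[OF h, of "\<lambda>x. x"], of "\<lambda>B. B ** Q"]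
    by (simp add: mat_fun_ident[OF h] matrix_mult.sum_left matrix_mult.scaleR_left
        linear_sum[OF linear_trace] linear_scale[OF linear_trace] trace_eigenproj_mult[OF h Q(1,2)])
  have "\<exists>x\<in>eigvals A. eigenproj A x ** Q \<noteq> 0"
  proof (rule ccontr)
    assume "\<not> ?thesis"
    then have "(\<Sum>x\<in>eigvals A. eigenproj A x) ** Q = 0"
      by (simp add: matrix_mult.sum_left)
    then show False using Q(3) by (simp add: sum_eigenproj[OF h])
  qed
  then obtain x where "x \<in> eigvals A" "eigenproj A x ** Q \<noteq> 0" by blast
  then have "0 < x * (norm (eigenproj A x ** Q))\<^sup>2"
    using A by (simp add: positive_definite_def)
  then show ?thesis unfolding eq using finite_eigvals[OF h] nn \<open>x \<in> eigvals A\<close>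
    by (intro sum_pos2[of _ x]) auto
qed

text \<open>The spectral projections of the expectation lie in \<open>N\<close>, so pairing one with
  the expectation or with \<open>X\<close> gives the same trace. The former is the eigenvalue times
  a squared norm, the latter is positive.\<close>

lemma positive_definite_tracial_cond_exp:
  assumes N: "star_subalgebra N" and X: "positive_definite X"
  shows "positive_definite (tracial_cond_exp N X)"
proof -
  define Y where "Y = tracial_cond_exp N X"
  have h: "cadj Y = Y"
    using X cadj_tracial_cond_exp[OF N] by (simp add: Y_def positive_definite_def)
  have "0 < x" if "x \<in> eigvals Y" for x
  proof -
    define Q where "Q = eigenproj Y x"
    have Q: "cadj Q = Q" "Q ** Q = Q" "Q \<noteq> 0"
      using that by (simp_all add: Q_def cadj_eigenproj[OF h] eigenproj_mult[OF h] eigvals_def)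
    have "Q \<in> N" unfolding Q_def
      by (rule eigenproj_mem[OF N _ h]) (simp add: Y_def tracial_cond_exp_mem[OF N])
    have QY: "Q ** Y = x *\<^sub>R Q" unfolding Q_def by (rule mult_eigenproj(2)[OF h])
    have "trace (Q ** Y) = x *\<^sub>R trace Q"
      unfolding QY by (rule linear_scale[OF linear_trace])
    moreover have "Re (trace Q) = (norm Q)\<^sup>2"
      using inner_eq_trace[of Q Q] by (simp only: Q power2_norm_eq_inner)
    ultimately have Re: "Re (trace (Q ** Y)) = x * (norm Q)\<^sup>2" by simp
    have "0 < Re (trace (X ** Q))" by (rule trace_mult_projection_pos[OF X Q])
    also have "trace (X ** Q) = trace (Q ** Y)"
      unfolding Y_def trace_tracial_cond_exp[OF N \<open>Q \<in> N\<close>] by (rule trace_mul_sym)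
    also note Re
    finally show ?thesis by (simp add: zero_less_mult_iff)
  qed
  then show ?thesis using h by (simp add: positive_definite_def Y_def)
qed

section \<open>Relative entropy and the relative modular operator\<close>

lemma eigenproj_products_orthogonal:
  assumes "cadj A = A" "cadj B = B" "(x, y) \<noteq> (x', y')"
  shows "inner (eigenproj A x ** eigenproj B y) (eigenproj A x' ** eigenproj B y') = 0"
proof -
  have left: "inner (eigenproj A x ** eigenproj B y) (eigenproj A x' ** eigenproj B y')
      = inner (eigenproj B y) ((eigenproj A x ** eigenproj A x') ** eigenproj B y')"
    unfolding inner_matrix_mult_left cadj_eigenproj[OF assms(1)] matrix_mul_assoc ..
  have right: "inner (eigenproj A x ** eigenproj B y) (eigenproj A x' ** eigenproj B y')
      = inner (eigenproj A x) (eigenproj A x' ** (eigenproj B y' ** eigenproj B y))"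
    unfolding inner_matrix_mult_right cadj_eigenproj[OF assms(2)] matrix_mul_assoc ..
  show ?thesis
  proof (cases "x = x'")
    case True
    then show ?thesis using assms(3) unfolding right eigenproj_mult[OF assms(2)] by simp
  next
    case False
    then show ?thesis unfolding left eigenproj_mult[OF assms(1)] by simp
  qed
qed

text \<open>The products of spectral projections diagonalise left multiplication by \<open>A\<close>
  and right multiplication by \<open>B\<close> simultaneously.\<close>

lemma mat_fun_mult_mat_fun_eq_sum:
  assumes "cadj A = A" "cadj B = B"
  shows "mat_fun f A ** mat_fun g B
    = (\<Sum>(x, y)\<in>eigvals A \<times> eigvals B. (f x * g y) *\<^sub>R (eigenproj A x ** eigenproj B y))"
  unfolding mat_fun_eq_sum[OF assms(1)] mat_fun_eq_sum[OF assms(2)] sum.cartesian_product[symmetric]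
  by (simp add: matrix_mult.sum_left matrix_mult.sum_right matrix_mult.scaleR_left
      matrix_mult.scaleR_right scaleR_sum_right mult.commute) (rule sum.swap)

lemma trace_mat_fun_mult_mat_fun:
  assumes "cadj A = A" "cadj B = B"
  shows "Re (trace (mat_fun f A ** mat_fun g B))
    = (\<Sum>(x, y)\<in>eigvals A \<times> eigvals B. f x * g y * (norm (eigenproj A x ** eigenproj B y))\<^sup>2)"
proof -
  have *: "Re (trace (eigenproj A x ** eigenproj B y)) = (norm (eigenproj A x ** eigenproj B y))\<^sup>2" for x y
    by (rule trace_eigenproj_mult[OF assms(1)]) (simp_all add: cadj_eigenproj eigenproj_mult assms)
  show ?thesis
    unfolding mat_fun_mult_mat_fun_eq_sum[OF assms] linear_sum[OF linear_trace] Re_sum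
    by (intro sum.cong refl) (auto simp: linear_scale[OF linear_trace] *)
qed

text \<open>For positive eigenvalues the coefficient is \<open>- y * ln (x / y)\<close>, where
  \<open>x / y\<close> is an eigenvalue of the relative modular operator; this matches the
  logarithmic sums in \<open>sqrt_difference_bound\<close>.\<close>

lemma rel_entropy_eq_sum:
  assumes "cadj A = A" "cadj B = B"
  shows "rel_entropy B A
    = (\<Sum>(x, y)\<in>eigvals A \<times> eigvals B. y * (ln y - ln x) * (norm (eigenproj A x ** eigenproj B y))\<^sup>2)"
proof -
  have "trace (B ** mat_log B) = trace (mat_fun (\<lambda>_. 1) A ** mat_fun (\<lambda>y. y * ln y) B)"
    using mat_fun_mult[OF assms(2), of "\<lambda>x. x" ln]
    by (simp add: mat_fun_const[OF assms(1)] mat_fun_ident[OF assms(2)] mat_log_def)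
  moreover have "trace (B ** mat_log A) = trace (mat_fun ln A ** mat_fun (\<lambda>y. y) B)"
    unfolding mat_fun_ident[OF assms(2)] mat_log_def by (rule trace_mul_sym)
  ultimately have "rel_entropy B A = Re (trace (mat_fun (\<lambda>_. 1) A ** mat_fun (\<lambda>y. y * ln y) B))
      - Re (trace (mat_fun ln A ** mat_fun (\<lambda>y. y) B))"
    by (simp add: rel_entropy_def matrix_mult.diff_right trace_sub)
  then show ?thesis
    unfolding trace_mat_fun_mult_mat_fun[OF assms] sum_subtractf[symmetric]
    by (simp add: case_prod_unfold algebra_simps)
qed

text \<open>Positivity of the spectrum matters already for \<open>mat_powr_0\<close>, since
  \<open>0 powr 0 = 0\<close>.\<close>

lemma mat_powr_laws:
  assumes A: "positive_definite A"
  shows mat_powr_mult: "mat_powr A s ** mat_powr A t = mat_powr A (s + t)"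
    and mat_powr_0: "mat_powr A 0 = mat 1"
    and mat_powr_1: "mat_powr A 1 = A"
    and cadj_mat_powr: "cadj (mat_powr A t) = mat_powr A t"
    and mat_powr_half: "mat_powr A (1/2) = mat_fun sqrt A"
    and matrix_inv_eq_mat_powr: "matrix_inv A = mat_powr A (-1)"
proof -
  have h: "cadj A = A" and pos: "\<And>x. x \<in> eigvals A \<Longrightarrow> 0 < x"
    using A by (auto simp: positive_definite_def)
  show mult: "mat_powr A s ** mat_powr A t = mat_powr A (s + t)" for s t
    by (simp add: mat_powr_def mat_fun_mult[OF h] powr_add)
  have "mat_powr A 0 = mat_fun (\<lambda>_. 1) A"
    unfolding mat_powr_def by (rule mat_fun_cong[OF h]) (use pos in fastforce)
  then show zero: "mat_powr A 0 = mat 1" by (simp add: mat_fun_const[OF h])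
  have "mat_powr A 1 = mat_fun (\<lambda>x. x) A"
    unfolding mat_powr_def by (rule mat_fun_cong[OF h]) (use pos in fastforce)
  then show one: "mat_powr A 1 = A" by (simp add: mat_fun_ident[OF h])
  show "cadj (mat_powr A t) = mat_powr A t" by (simp add: mat_powr_def cadj_mat_fun[OF h])
  show "mat_powr A (1/2) = mat_fun sqrt A"
    unfolding mat_powr_def
    by (rule mat_fun_cong[OF h]) (use pos in \<open>force simp: powr_half_sqrt\<close>)
  have inv: "A ** mat_powr A (-1) = mat 1" "mat_powr A (-1) ** A = mat 1"
    using mult[of 1 "-1"] mult[of "-1" 1] zero by (simp_all add: one)
  then have "A ** matrix_inv A = mat 1 \<and> matrix_inv A ** A = mat 1"
    unfolding matrix_inv_def by (intro someI[where P = "\<lambda>B. A ** B = mat 1 \<and> B ** A = mat 1"] conjI)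
  then have "mat_powr A (-1) ** A ** matrix_inv A = mat_powr A (-1)"
    by (simp add: matrix_mul_assoc[symmetric])
  then show "matrix_inv A = mat_powr A (-1)" by (simp add: inv)
qed

lemma trace_tracial_cond_exp_between:
  assumes "star_subalgebra N" "Y \<in> N" "Z \<in> N"
  shows "trace (Y ** tracial_cond_exp N X ** Z) = trace (Y ** X ** Z)"
proof -
  have "trace (Y ** W ** Z) = trace ((Z ** Y) ** W)" for W
    unfolding matrix_mul_assoc[symmetric] by (subst trace_mul_sym) (simp only: matrix_mul_assoc)
  then show ?thesis
    using trace_tracial_cond_exp[OF assms(1) star_subalgebraD(3)[OF assms(1,3,2)]] by simp
qed

text \<open>Undoing the multiplications recovers the identity matrix. This makes the constant
  \<open>L\<close> of the resolvent estimate strictly positive.\<close>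

lemma rel_modular_sqrt_nonzero:
  fixes A B :: "complex^'n^'n"
  assumes A: "positive_definite A" and B: "positive_definite B"
  shows "rel_modular A B (mat_powr B (1/2)) \<noteq> 0"
proof
  assume zero: "rel_modular A B (mat_powr B (1/2)) = 0"
  have "mat_powr A (-1) ** rel_modular A B (mat_powr B (1/2)) ** mat_powr B (1/2)
      = (mat_powr A (-1) ** mat_powr A 1) ** (mat_powr B (1/2) ** mat_powr B (-1) ** mat_powr B (1/2))"
    unfolding rel_modular_def matrix_inv_eq_mat_powr[OF B] mat_powr_1[OF A]
    by (simp only: matrix_mul_assoc)
  also have "\<dots> = mat 1"
    by (simp add: mat_powr_mult[OF A] mat_powr_mult[OF B] mat_powr_0[OF A] mat_powr_0[OF B])
  finally have "(mat 1 :: complex^'n^'n) = 0" by (simp add: zero)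
  then have "(mat 1 :: complex^'n^'n) $ i $ i = 0" for i by simp
  then show False by (simp add: mat_def)
qed

text \<open>Right multiplication by \<open>G\<close> is the isometry that compresses the relative modular operator
  of \<open>A\<close> and \<open>B\<close> to that of their conditional expectations.\<close>

lemma sqrt_difference_rel_entropy_bound:
  fixes A B :: "complex^'n^'n"
  assumes N: "star_subalgebra N" and A: "positive_definite A" and B: "positive_definite B"
    and A': "A' = tracial_cond_exp N A" and B': "B' = tracial_cond_exp N B"
    and G: "G = mat_powr B' (-1/2) ** mat_powr B (1/2)"
  shows inner_mult_compression: "X \<in> N \<Longrightarrow> Y \<in> N \<Longrightarrow> inner (X ** G) (Y ** G) = inner X Y"
    and "(pi / 4 * norm (mat_powr A (1/2) - mat_powr A' (1/2) ** G)) ^ 4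
      \<le> (norm (rel_modular A B (mat_powr B (1/2))))\<^sup>2 * (rel_entropy B A - rel_entropy B' A')"
proof -
  have A'p: "positive_definite A'" and B'p: "positive_definite B'"
    unfolding A' B' using positive_definite_tracial_cond_exp[OF N] A B by auto
  have hA: "cadj A = A" and hB: "cadj B = B" and hA': "cadj A' = A'" and hB': "cadj B' = B'"
    using A B A'p B'p by (auto simp: positive_definite_def)
  have posA: "x \<in> eigvals A \<Longrightarrow> 0 < x" and posB: "x \<in> eigvals B \<Longrightarrow> 0 < x"
    and posA': "x \<in> eigvals A' \<Longrightarrow> 0 < x" and posB': "x \<in> eigvals B' \<Longrightarrow> 0 < x" for x
    using A B A'p B'p by (auto simp: positive_definite_def)
  have A'N: "A' \<in> N" and B'N: "B' \<in> N" by (simp_all add: A' B' tracial_cond_exp_mem[OF N])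
  have powrN: "mat_powr B' t \<in> N" for t
    unfolding mat_powr_def by (rule mat_fun_mem[OF N B'N hB'])
  have cadjG: "cadj G = mat_powr B (1/2) ** mat_powr B' (-1/2)"
    by (simp add: G cadj_mult cadj_mat_powr[OF B] cadj_mat_powr[OF B'p])
  have GG: "G ** cadj G = mat_powr B' (-1/2) ** B ** mat_powr B' (-1/2)"
  proof -
    have "G ** cadj G = mat_powr B' (-1/2) ** (mat_powr B (1/2) ** mat_powr B (1/2)) ** mat_powr B' (-1/2)"
      unfolding cadjG by (simp only: G matrix_mul_assoc)
    then show ?thesis by (simp add: mat_powr_mult[OF B] mat_powr_1[OF B])
  qed
  \<comment> \<open>The powers of \<open>B\<close> cancel exactly here, so no conditional
    expectation is involved.\<close>
  have GBG: "G ** matrix_inv B ** cadj G = matrix_inv B'"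
  proof -
    have "G ** matrix_inv B ** cadj G = mat_powr B' (-1/2)
        ** (mat_powr B (1/2) ** mat_powr B (-1) ** mat_powr B (1/2)) ** mat_powr B' (-1/2)"
      unfolding cadjG matrix_inv_eq_mat_powr[OF B] by (simp only: G matrix_mul_assoc)
    also have "mat_powr B (1/2) ** mat_powr B (-1) ** mat_powr B (1/2) = mat 1"
      by (simp add: mat_powr_mult[OF B] mat_powr_0[OF B])
    finally show ?thesis
      by (simp add: mat_powr_mult[OF B'p] matrix_inv_eq_mat_powr[OF B'p])
  qed
  have BBB: "mat_powr B' (-1/2) ** B' ** mat_powr B' (-1/2) = mat 1"
    using mat_powr_mult[OF B'p, of "-1/2" 1] mat_powr_mult[OF B'p, of "1/2" "-1/2"]
    by (simp add: mat_powr_1[OF B'p] mat_powr_0[OF B'p])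
  \<comment> \<open>Inside the trace \<open>B\<close> stands between elements of \<open>N\<close>,
    so \<open>B'\<close> may replace it, and the outer powers of \<open>B'\<close> then cancel
    it.\<close>
  show iso: "inner (X ** G) (Y ** G) = inner X Y" if "X \<in> N" "Y \<in> N" for X Y
  proof -
    have "inner (X ** G) (Y ** G) = inner X (Y ** (G ** cadj G))"
      by (simp only: inner_matrix_mult_right matrix_mul_assoc)
    also have "\<dots> = Re (trace ((cadj X ** Y ** mat_powr B' (-1/2)) ** B ** mat_powr B' (-1/2)))"
      unfolding GG inner_eq_trace by (simp only: matrix_mul_assoc)
    also have "\<dots> = Re (trace ((cadj X ** Y ** mat_powr B' (-1/2)) ** B' ** mat_powr B' (-1/2)))"
      unfolding B'[symmetric] using trace_tracial_cond_exp_between[OF N _ powrN] B'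
        star_subalgebraD(3)[OF N star_subalgebraD(3)[OF N star_subalgebraD(5)[OF N that(1)] that(2)] powrN]
      by simp
    also have "(cadj X ** Y ** mat_powr B' (-1/2)) ** B' ** mat_powr B' (-1/2) =
        cadj X ** Y ** (mat_powr B' (-1/2) ** B' ** mat_powr B' (-1/2))"
      by (simp only: matrix_mul_assoc)
    finally show ?thesis unfolding BBB matrix_mul_rid inner_eq_trace .
  qed
  define T where "T = rel_modular A B"
  \<comment> \<open>By \<open>GBG\<close> the factor \<open>A\<close> stands between
    \<open>cadj X\<close> and \<open>Y ** matrix_inv B'\<close>, both in \<open>N\<close>, and may
    be replaced by \<open>A'\<close>.\<close>
  have compress: "inner (X ** G) (T (Y ** G)) = inner X (rel_modular A' B' Y)" if "X \<in> N" "Y \<in> N" for X Y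
  proof -
    have mem: "Y ** matrix_inv B' \<in> N"
      unfolding matrix_inv_eq_mat_powr[OF B'p] by (intro star_subalgebraD(3)[OF N] that powrN)
    have "inner (X ** G) (T (Y ** G)) = inner X (A ** Y ** (G ** matrix_inv B ** cadj G))"
      unfolding T_def rel_modular_def inner_matrix_mult_right by (simp only: matrix_mul_assoc)
    also have "\<dots> = Re (trace (cadj X ** A ** (Y ** matrix_inv B')))"
      unfolding GBG inner_eq_trace by (simp only: matrix_mul_assoc)
    also have "\<dots> = Re (trace (cadj X ** A' ** (Y ** matrix_inv B')))"
      using trace_tracial_cond_exp_between[OF N star_subalgebraD(5)[OF N that(1)] mem, of A] by (simp add: A')
    also have "\<dots> = inner X (rel_modular A' B' Y)"
      unfolding inner_eq_trace rel_modular_def by (simp only: matrix_mul_assoc)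
    finally show ?thesis .
  qed
  have modular_eigen: "rel_modular X Y (eigenproj X x ** eigenproj Y y) = (x / y) *\<^sub>R (eigenproj X x ** eigenproj Y y)"
    if X: "positive_definite X" and Y: "positive_definite Y" and y: "y \<in> eigvals Y" for X Y :: "complex^'n^'n" and x y
  proof -
    have hX: "cadj X = X" and hY: "cadj Y = Y" and "0 < y" using X Y y by (auto simp: positive_definite_def)
    have "rel_modular X Y (eigenproj X x ** eigenproj Y y)
       = (X ** eigenproj X x) ** (eigenproj Y y ** matrix_inv Y)"
      unfolding rel_modular_def by (simp only: matrix_mul_assoc)
    also have "\<dots> = (x *\<^sub>R eigenproj X x) ** ((y powr -1) *\<^sub>R eigenproj Y y)"
      unfolding mult_eigenproj(1)[OF hX] matrix_inv_eq_mat_powr[OF Y] mat_powr_def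
        eigenproj_mult_mat_fun[OF hY] ..
    finally show ?thesis using \<open>0 < y\<close>
      by (simp add: matrix_mult.scaleR_left matrix_mult.scaleR_right powr_minus divide_inverse)
  qed
  \<comment> \<open>The weight \<open>sqrt y\<close> makes these the components of
    \<open>mat_powr B (1/2)\<close> along eigenvectors of \<open>T\<close>; \<open>b\<close> does
    the same for \<open>A'\<close> and \<open>B'\<close>, and \<open>c\<close> transports
    \<open>b\<close> by the isometry.\<close>
  define a where "a = (\<lambda>(x, y). sqrt y *\<^sub>R (eigenproj A x ** eigenproj B y))"
  define b where "b = (\<lambda>(x, y). sqrt y *\<^sub>R (eigenproj A' x ** eigenproj B' y))"
  define c where "c p = b p ** G" for p
  define q :: "real \<times> real \<Rightarrow> real" where "q = (\<lambda>(x, y). x / y)"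
  define K where "K = eigvals A \<times> eigvals B"
  define I where "I = eigvals A' \<times> eigvals B'"
  have linT: "linear T"
    unfolding T_def rel_modular_def
    by (rule linearI) (simp_all add: matrix_mult.add_left matrix_mult.add_right
        matrix_mult.scaleR_left matrix_mult.scaleR_right)
  have lin': "rel_modular A' B' (r *\<^sub>R X) = r *\<^sub>R rel_modular A' B' X" for r X
    by (simp add: rel_modular_def matrix_mult.scaleR_left matrix_mult.scaleR_right)
  have bN: "b p \<in> N" for p
    using star_subalgebra_subspace[OF N] eigenproj_mem[OF N A'N hA'] eigenproj_mem[OF N B'N hB']
    by (auto simp: b_def split: prod.split intro!: subspace_scale star_subalgebraD(3)[OF N])
  have cc: "inner (c p) (c p') = inner (b p) (b p')" for p p'
    unfolding c_def by (rule iso[OF bN bN])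
  have ent: "(\<Sum>p\<in>eigvals X \<times> eigvals Y. (norm ((\<lambda>(x, y). sqrt y *\<^sub>R (eigenproj X x ** eigenproj Y y)) p))\<^sup>2
       * ln (case p of (x, y) \<Rightarrow> x / y)) = - rel_entropy Y X"
    if X: "positive_definite X" and Y: "positive_definite Y" for X Y :: "complex^'n^'n"
  proof -
    have hX: "cadj X = X" and hY: "cadj Y = Y" using X Y by (auto simp: positive_definite_def)
    show ?thesis
      unfolding rel_entropy_eq_sum[OF hX hY] sum_negf[symmetric]
    proof (rule sum.cong[OF refl])
      fix p assume "p \<in> eigvals X \<times> eigvals Y"
      then obtain x y where p: "p = (x, y)" "0 < x" "0 < y"
        using X Y by (auto simp: positive_definite_def)
      show "(norm ((\<lambda>(x, y). sqrt y *\<^sub>R (eigenproj X x ** eigenproj Y y)) p))\<^sup>2 * ln (case p of (x, y) \<Rightarrow> x / y)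
        = - (case p of (x, y) \<Rightarrow> y * (ln y - ln x) * (norm (eigenproj X x ** eigenproj Y y))\<^sup>2)"
        using p(2,3) by (simp add: p(1) power_mult_distrib ln_div algebra_simps)
    qed
  qed
  have sum_sqrt: "mat_fun f X ** mat_powr Y (1/2)
      = (\<Sum>p\<in>eigvals X \<times> eigvals Y. f (fst p) *\<^sub>R (case p of (x, y) \<Rightarrow> sqrt y *\<^sub>R (eigenproj X x ** eigenproj Y y)))"
    if "positive_definite X" "positive_definite Y" for X Y :: "complex^'n^'n" and f
    using that unfolding mat_powr_half[OF that(2)]
    by (subst mat_fun_mult_mat_fun_eq_sum) (auto simp: positive_definite_def intro!: sum.cong)
  \<comment> \<open>Since \<open>sqrt (x / y) * sqrt y = sqrt x\<close>, the dependence on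
    \<open>y\<close> disappears and the sum over the second spectrum collapses to the
    identity.\<close>
  have sqrt_q: "sqrt (case p of (x, y) \<Rightarrow> x / y) *\<^sub>R (case p of (x, y) \<Rightarrow> sqrt y *\<^sub>R (eigenproj X x ** eigenproj Y y))
      = sqrt (fst p) *\<^sub>R (case p of (x, y) \<Rightarrow> eigenproj X x ** eigenproj Y y)"
    if "snd p > 0" for p and X Y :: "complex^'n^'n"
    using that by (cases p) (simp add: real_sqrt_divide)
  have sum_q: "(\<Sum>p\<in>eigvals X \<times> eigvals Y. sqrt (case p of (x, y) \<Rightarrow> x / y)
      *\<^sub>R (case p of (x, y) \<Rightarrow> sqrt y *\<^sub>R (eigenproj X x ** eigenproj Y y))) = mat_powr X (1/2)"
    if X: "positive_definite X" and Y: "positive_definite Y" for X Y :: "complex^'n^'n"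
  proof -
    have hX: "cadj X = X" and hY: "cadj Y = Y" using X Y by (auto simp: positive_definite_def)
    have "mat_powr X (1/2) = mat_fun sqrt X ** mat_fun (\<lambda>_. 1) Y"
      by (simp add: mat_powr_half[OF X] mat_fun_const[OF hY])
    also have "\<dots> = (\<Sum>p\<in>eigvals X \<times> eigvals Y. sqrt (fst p) *\<^sub>R (case p of (x, y) \<Rightarrow> eigenproj X x ** eigenproj Y y))"
      unfolding mat_fun_mult_mat_fun_eq_sum[OF hX hY] by (intro sum.cong) auto
    also have "\<dots> = (\<Sum>p\<in>eigvals X \<times> eigvals Y. sqrt (case p of (x, y) \<Rightarrow> x / y)
      *\<^sub>R (case p of (x, y) \<Rightarrow> sqrt y *\<^sub>R (eigenproj X x ** eigenproj Y y)))"
      using Y by (intro sum.cong refl sqrt_q[symmetric]) (auto simp: positive_definite_def)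
    finally show ?thesis by simp
  qed
  have sum_one: "(\<Sum>p\<in>eigvals X \<times> eigvals Y. (case p of (x, y) \<Rightarrow> sqrt y *\<^sub>R (eigenproj X x ** eigenproj Y y)))
      = mat_powr Y (1/2)"
    if X: "positive_definite X" and Y: "positive_definite Y" for X Y :: "complex^'n^'n"
    using sum_sqrt[OF X Y, of "\<lambda>_. 1"] X by (simp add: mat_fun_const positive_definite_def)
  define e where "e = mat_powr B (1/2)"
  have e_nonzero: "T e \<noteq> 0"
    unfolding T_def e_def by (rule rel_modular_sqrt_nonzero[OF A B])
  have "(pi / 4 * norm ((\<Sum>p\<in>K. sqrt (q p) *\<^sub>R a p) - (\<Sum>p\<in>I. sqrt (q p) *\<^sub>R c p))) ^ 4
     \<le> (norm (T e))\<^sup>2 * ((\<Sum>p\<in>I. (norm (c p))\<^sup>2 * ln (q p)) - (\<Sum>p\<in>K. (norm (a p))\<^sup>2 * ln (q p)))"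
  \<comment> \<open>The constant \<open>L\<close> is taken to be \<open>norm (T e)\<close> itself;
    the operator norm enters only in the final theorem.\<close>
  proof (rule sqrt_difference_bound[where T = T and e = e])
    show "finite K" "finite I" unfolding K_def I_def using finite_eigvals hA hB hA' hB' by blast+
    show "inner (a k) (a k') = 0" if "k \<noteq> k'" for k k'
      using that eigenproj_products_orthogonal[OF hA hB] by (auto simp: a_def split: prod.splits)
    show "inner (c l) (c l') = 0" if "l \<noteq> l'" for l l'
      unfolding cc using that eigenproj_products_orthogonal[OF hA' hB'] by (auto simp: b_def split: prod.splits)
    show "0 < q k" if "k \<in> K" for k using that posA posB by (auto simp: K_def q_def)
    show "0 < q l" if "l \<in> I" for l using that posA' posB' by (auto simp: I_def q_def)
    show "linear T" by (rule linT)
    have hinv: "cadj (matrix_inv B) = matrix_inv B"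
      by (simp add: matrix_inv_eq_mat_powr[OF B] cadj_mat_powr[OF B])
    show "inner X (T Y) = inner (T X) Y" for X Y
      unfolding T_def rel_modular_def inner_matrix_mult_right[of "A ** X"] inner_matrix_mult_left[of A X]
        hA hinv by (simp only: matrix_mul_assoc)
    show "0 \<le> inner X (T X)" for X
    proof -
      \<comment> \<open>\<open>T\<close> is the square of the symmetric map that sends
        \<open>X\<close> to \<open>mat_powr A (1/2) ** X ** mat_powr B (-1/2)\<close>, hence
        positive.\<close>
      have "T X = mat_powr A (1/2) ** (mat_powr A (1/2) ** X ** mat_powr B (-1/2)) ** mat_powr B (-1/2)"
        using mat_powr_mult[OF A, of "1/2" "1/2"] mat_powr_mult[OF B, of "-1/2" "-1/2"]
        unfolding T_def rel_modular_def matrix_inv_eq_mat_powr[OF B]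
        by (simp add: mat_powr_1[OF A] matrix_mul_assoc) (simp add: matrix_mul_assoc[symmetric])
      then have "inner X (T X) = inner (mat_powr A (1/2) ** X ** mat_powr B (-1/2))
          (mat_powr A (1/2) ** X ** mat_powr B (-1/2))"
        unfolding inner_matrix_mult_right[of "mat_powr A (1/2) ** X"] inner_matrix_mult_left[of "mat_powr A (1/2)" X]
          cadj_mat_powr[OF A] cadj_mat_powr[OF B] by (simp only: matrix_mul_assoc)
      then show ?thesis by simp
    qed
    show "T (a k) = q k *\<^sub>R a k" if "k \<in> K" for k
      using that modular_eigen[OF A B] linear_scale[OF linT]
      by (auto simp: a_def q_def K_def T_def)
    show "inner (c l') (T (c l)) = q l * inner (c l') (c l)" if "l \<in> I" for l l'
    proof -
      have "rel_modular A' B' (b l) = q l *\<^sub>R b l"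
        using that modular_eigen[OF A'p B'p] by (auto simp: b_def q_def I_def lin')
      then show ?thesis unfolding cc unfolding c_def compress[OF bN bN] by simp
    qed
    show "e = (\<Sum>p\<in>K. a p)" unfolding e_def K_def a_def by (rule sum_one[OF A B, symmetric])
    have "(\<Sum>p\<in>I. c p) = mat_powr B' (1/2) ** G"
      using sum_one[OF A'p B'p] by (simp add: I_def b_def c_def matrix_mult.sum_left[symmetric])
    also have "\<dots> = e"
      using mat_powr_mult[OF B'p, of "1/2" "-1/2"]
      by (simp add: G e_def matrix_mul_assoc mat_powr_0[OF B'p])
    finally show "e = (\<Sum>p\<in>I. c p)" by simp
    show "0 < norm (T e)" using e_nonzero by simp
  qed simp
  moreover have "(\<Sum>p\<in>K. sqrt (q p) *\<^sub>R a p) = mat_powr A (1/2)"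
    using sum_q[OF A B] by (simp add: K_def q_def a_def)
  moreover have "(\<Sum>p\<in>I. sqrt (q p) *\<^sub>R c p) = mat_powr A' (1/2) ** G"
    using sum_q[OF A'p B'p]
    by (simp add: I_def q_def b_def c_def matrix_mult.sum_left[symmetric] matrix_mult.scaleR_left[symmetric])
  moreover have "(\<Sum>p\<in>K. (norm (a p))\<^sup>2 * ln (q p)) = - rel_entropy B A"
    using ent[OF A B] by (simp add: K_def q_def a_def)
  moreover have "(\<Sum>p\<in>I. (norm (c p))\<^sup>2 * ln (q p)) = - rel_entropy B' A'"
  proof -
    have "norm (c p) = norm (b p)" for p by (simp add: norm_eq_sqrt_inner cc)
    then show ?thesis using ent[OF A'p B'p] by (simp add: I_def q_def b_def)
  qed
  ultimately show "(pi / 4 * norm (mat_powr A (1/2) - mat_powr A' (1/2) ** G)) ^ 4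
      \<le> (norm (rel_modular A B (mat_powr B (1/2))))\<^sup>2 * (rel_entropy B A - rel_entropy B' A')"
    by (simp add: T_def e_def)
qed

section \<open>Trace norm and the recovery bound\<close>

text \<open>For Hermitian \<open>C\<close> the square root of \<open>cadj C ** C\<close> is the
  absolute value of \<open>C\<close>. The sign function takes the value 1 at 0, so that the sign
  matrix squares to the identity.\<close>

lemma trace_norm_eq_sum:
  assumes h: "cadj C = C"
  shows "trace_norm C = (\<Sum>x\<in>eigvals C. \<bar>x\<bar> * (norm (eigenproj C x))\<^sup>2)"
    and "trace_norm C = Re (trace (mat_fun (\<lambda>x. if 0 \<le> x then 1 else -1) C ** C))"
proof -
  have "cadj C ** C = mat_fun (\<lambda>x. x * x) C"
    unfolding h mat_fun_mult[OF h, symmetric] mat_fun_ident[OF h] ..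
  then have "mat_powr (cadj C ** C) (1/2) = mat_fun (\<lambda>x. (x * x) powr (1/2)) C"
    by (simp add: mat_powr_def mat_fun_mat_fun[OF h])
  also have "(\<lambda>x::real. (x * x) powr (1/2)) = abs"
    by (auto simp: powr_half_sqrt)
  finally have abs: "trace_norm C = Re (trace (mat_fun abs C))" by (simp add: trace_norm_def)
  have "Re (trace (eigenproj C x)) = (norm (eigenproj C x))\<^sup>2" for x
    using trace_eigenproj_mult[OF h, of "mat 1" x] by simp
  then show "trace_norm C = (\<Sum>x\<in>eigvals C. \<bar>x\<bar> * (norm (eigenproj C x))\<^sup>2)"
    unfolding abs mat_fun_eq_sum[OF h]
    by (simp add: linear_sum[OF linear_trace] linear_scale[OF linear_trace])
  have "abs = (\<lambda>x::real. (if 0 \<le> x then 1 else -1) * x)" by (auto simp: abs_if)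
  then have "mat_fun abs C = mat_fun (\<lambda>x. (if 0 \<le> x then 1 else -1) * x) C" by simp
  also have "\<dots> = mat_fun (\<lambda>x. if 0 \<le> x then 1 else -1) C ** C"
    unfolding mat_fun_mult[OF h, symmetric] mat_fun_ident[OF h] ..
  finally show "trace_norm C = Re (trace (mat_fun (\<lambda>x. if 0 \<le> x then 1 else -1) C ** C))"
    by (simp add: abs)
qed

lemma trace_norm_nonneg: "cadj C = C \<Longrightarrow> 0 \<le> trace_norm C"
  by (simp add: trace_norm_eq_sum(1) sum_nonneg)

text \<open>Pair the difference with its sign matrix \<open>J\<close>, which preserves norms under
  right multiplication, split it as \<open>cadj X ** (X - Y) + cadj (X - Y) ** Y\<close>, and apply
  Cauchy-Schwarz to each part. For unit vectors this is the factor 2.\<close>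

lemma trace_norm_gram_diff_le:
  fixes X Y :: "complex^'n^'n"
  shows "trace_norm (cadj X ** X - cadj Y ** Y) \<le> norm (X - Y) * (norm X + norm Y)"
proof -
  define C where "C = cadj X ** X - cadj Y ** Y"
  have h: "cadj C = C" by (simp add: C_def linear_diff[OF linear_cadj] cadj_mult)
  define J where "J = mat_fun (\<lambda>x. if 0 \<le> x then 1 else -1) C"
  have hJ: "cadj J = J" by (simp add: J_def cadj_mat_fun[OF h])
  have "(\<lambda>x::real. (if 0 \<le> x then 1 else -1) * (if 0 \<le> x then 1 else -1)) = (\<lambda>_. 1 :: real)" by auto
  then have JJ: "J ** J = mat 1"
    unfolding J_def mat_fun_mult[OF h] by (simp add: mat_fun_const[OF h])
  have normJ: "norm (Z ** J) = norm Z" for Z :: "complex^'n^'n"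
    unfolding norm_eq_sqrt_inner inner_matrix_mult_right hJ
    by (simp add: matrix_mul_assoc[symmetric] JJ)
  have tr: "Re (trace (J ** (cadj U ** V))) = inner (U ** J) V" for U V
    by (simp add: inner_eq_trace cadj_mult hJ matrix_mul_assoc)
  have "C = cadj X ** (X - Y) + cadj (X - Y) ** Y"
    by (simp add: C_def linear_diff[OF linear_cadj] matrix_mult.diff_left matrix_mult.diff_right)
  then have "trace_norm C = inner (X ** J) (X - Y) + inner ((X - Y) ** J) Y"
    unfolding trace_norm_eq_sum(2)[OF h] J_def[symmetric]
    by (simp add: matrix_mult.add_right trace_add tr)
  also have "\<dots> \<le> norm (X ** J) * norm (X - Y) + norm ((X - Y) ** J) * norm Y"
    by (intro add_mono norm_cauchy_schwarz)
  finally show ?thesis by (simp add: normJ C_def algebra_simps)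
qed

section \<open>The operator norm and the final estimate\<close>

text \<open>The supremum is over a bounded set, because the quotients are bounded by the operator
  norm on the whole matrix space.\<close>

lemma norm_le_onorm_on:
  assumes "linear T" "X \<in> M"
  shows "norm (T X) / norm X \<le> onorm_on M T"
  unfolding onorm_on_def
proof (rule cSUP_upper[OF assms(2)])
  show "bdd_above ((\<lambda>X. norm (T X) / norm X) ` M)"
    using le_onorm assms(1) by (auto simp: linear_conv_bounded_linear intro!: bdd_aboveI2)
qed

lemma norm_mat_powr_half:
  assumes "positive_definite A" "trace A = 1"
  shows "norm (mat_powr A (1/2)) = 1"
  using mat_powr_mult[OF assms(1), of "1/2" "1/2"]
  by (simp add: norm_eq_sqrt_inner inner_eq_trace cadj_mat_powr[OF assms(1)] mat_powr_1[OF assms(1)] assms(2))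

theorem corollary1p7:
  fixes M N :: "(complex^'n^'n) set" and \<rho> \<sigma> \<rho>\<^sub>N \<sigma>\<^sub>N :: "complex^'n^'n"
  assumes "star_subalgebra M"
    and "star_subalgebra N" and "N \<subseteq> M"
    and "faithful_state M \<rho>" and "faithful_state M \<sigma>"
    and "\<rho>\<^sub>N = tracial_cond_exp N \<rho>" and "\<sigma>\<^sub>N = tracial_cond_exp N \<sigma>"
  shows "rel_entropy \<rho> \<sigma> - rel_entropy \<rho>\<^sub>N \<sigma>\<^sub>N
      \<ge> (pi / 8) ^ 4 * onorm_on M (rel_modular \<sigma> \<rho>) powi (-2)
        * trace_norm (petz_recovery N \<rho> \<sigma>\<^sub>N - \<sigma>) ^ 4"
proof -
  note N = \<open>star_subalgebra N\<close>
  have \<rho>: "positive_definite \<rho>" "\<rho> \<in> M" "trace \<rho> = 1" and \<sigma>: "positive_definite \<sigma>" "trace \<sigma> = 1"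
    using assms(4,5) by (auto simp: faithful_state_def psd_invertible_positive_definite)
  have \<rho>N: "positive_definite \<rho>\<^sub>N" and \<sigma>N: "positive_definite \<sigma>\<^sub>N"
    unfolding assms(6,7) by (rule positive_definite_tracial_cond_exp[OF N], fact)+
  have h: "cadj \<rho> = \<rho>" "cadj \<sigma>\<^sub>N = \<sigma>\<^sub>N" using \<rho> \<sigma>N by (auto simp: positive_definite_def)
  have tr\<sigma>N: "trace \<sigma>\<^sub>N = 1"
    using trace_tracial_cond_exp[OF N star_subalgebraD(1)[OF N], of \<sigma>] \<sigma> by (simp add: assms(7))
  define G where "G = mat_powr \<rho>\<^sub>N (-1/2) ** mat_powr \<rho> (1/2)"
  define X where "X = mat_powr \<sigma>\<^sub>N (1/2) ** G"
  define Y where "Y = mat_powr \<sigma> (1/2)"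
  define L where "L = norm (rel_modular \<sigma> \<rho> (mat_powr \<rho> (1/2)))"
  define D where "D = rel_entropy \<rho> \<sigma> - rel_entropy \<rho>\<^sub>N \<sigma>\<^sub>N"
  define t where "t = trace_norm (petz_recovery N \<rho> \<sigma>\<^sub>N - \<sigma>)"
  have bound: "(pi / 4 * norm (Y - X)) ^ 4 \<le> L\<^sup>2 * D"
    unfolding X_def Y_def L_def D_def
    by (rule sqrt_difference_rel_entropy_bound(2)[OF N \<sigma>(1) \<rho>(1) assms(7,6) G_def])
  have \<sigma>N_mem: "mat_powr \<sigma>\<^sub>N (1/2) \<in> N"
    unfolding mat_powr_def
    by (rule mat_fun_mem[OF N _ h(2)]) (simp add: assms(7) tracial_cond_exp_mem[OF N])
  \<comment> \<open>\<open>mat_powr \<sigma>\<^sub>N (1/2)\<close> lies in \<open>N\<close>, where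
    right multiplication by \<open>G\<close> is isometric.\<close>
  have "norm X = norm (mat_powr \<sigma>\<^sub>N (1/2))"
    unfolding X_def norm_eq_sqrt_inner
      inner_mult_compression[OF N \<sigma>(1) \<rho>(1) assms(7,6) G_def \<sigma>N_mem \<sigma>N_mem] ..
  then have X1: "norm X = 1" by (simp add: norm_mat_powr_half[OF \<sigma>N tr\<sigma>N])
  have Y1: "norm Y = 1" unfolding Y_def by (rule norm_mat_powr_half[OF \<sigma>])
  have "cadj X ** X = cadj G ** (mat_powr \<sigma>\<^sub>N (1/2) ** mat_powr \<sigma>\<^sub>N (1/2)) ** G"
    unfolding X_def cadj_mult cadj_mat_powr[OF \<sigma>N] by (simp only: matrix_mul_assoc)
  also have "\<dots> = petz_recovery N \<rho> \<sigma>\<^sub>N"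
    unfolding petz_recovery_def Let_def assms(6)[symmetric] G_def cadj_mult
      cadj_mat_powr[OF \<rho>N] cadj_mat_powr[OF \<rho>(1)]
    by (simp add: mat_powr_mult[OF \<sigma>N] mat_powr_1[OF \<sigma>N] matrix_mul_assoc)
  finally have XX: "petz_recovery N \<rho> \<sigma>\<^sub>N = cadj X ** X" by simp
  have YY: "\<sigma> = cadj Y ** Y"
    using mat_powr_mult[OF \<sigma>(1), of "1/2" "1/2"]
    by (simp add: Y_def cadj_mat_powr[OF \<sigma>(1)] mat_powr_1[OF \<sigma>(1)])
  have t: "0 \<le> t" "t \<le> 2 * norm (Y - X)"
  proof -
    have t_eq: "t = trace_norm (cadj X ** X - cadj Y ** Y)"
      unfolding t_def XX by (simp only: YY[symmetric])
    show "0 \<le> t" unfolding t_eq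
      by (rule trace_norm_nonneg) (simp add: linear_diff[OF linear_cadj] cadj_mult)
    show "t \<le> 2 * norm (Y - X)"
      using trace_norm_gram_diff_le[of X Y] unfolding t_eq by (simp add: X1 Y1 norm_minus_commute)
  qed
  \<comment> \<open>The factor 2 lost in passing to the trace norm turns \<open>pi / 4\<close> into
    \<open>pi / 8\<close>.\<close>
  have "(pi / 8 * t) ^ 4 \<le> (pi / 4 * norm (Y - X)) ^ 4"
    using t by (intro power_mono) auto
  from this bound have tD: "(pi / 8) ^ 4 * t ^ 4 \<le> L\<^sup>2 * D"
    unfolding power_mult_distrib[of "pi / 8", symmetric] by (rule order_trans)
  \<comment> \<open>This square root is a unit vector of \<open>M\<close>, so \<open>L\<close> is
    one of the quotients under the supremum.\<close>
  have mem: "mat_powr \<rho> (1/2) \<in> M"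
    unfolding mat_powr_def by (rule mat_fun_mem[OF assms(1) \<rho>(2) h(1)])
  have "linear (rel_modular \<sigma> \<rho>)"
    unfolding rel_modular_def
    by (rule linearI) (simp_all add: matrix_mult.add_left matrix_mult.add_right
        matrix_mult.scaleR_left matrix_mult.scaleR_right)
  from norm_le_onorm_on[OF this mem] have L_le: "L \<le> onorm_on M (rel_modular \<sigma> \<rho>)"
    by (simp add: L_def norm_mat_powr_half[OF \<rho>(1,3)])
  have "0 < L" using rel_modular_sqrt_nonzero[OF \<sigma>(1) \<rho>(1)] by (simp add: L_def)
  define m where "m = onorm_on M (rel_modular \<sigma> \<rho>)"
  have m: "0 < m" "L \<le> m" using L_le \<open>0 < L\<close> by (auto simp: m_def)
  \<comment> \<open>Monotonicity of the relative entropy follows from the bound itself, and is what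
    permits enlarging \<open>L\<close> to the operator norm.\<close>
  have "0 \<le> L\<^sup>2 * D" using bound by (rule order_trans[rotated]) simp
  then have "0 \<le> D" using \<open>0 < L\<close> by (simp add: zero_le_mult_iff)
  have "L\<^sup>2 * D \<le> m\<^sup>2 * D"
    using m \<open>0 < L\<close> \<open>0 \<le> D\<close> by (intro mult_right_mono power_mono) auto
  with tD have "(pi / 8) ^ 4 * t ^ 4 / m\<^sup>2 \<le> D"
    using m by (simp add: field_simps)
  moreover have "m powi (-2) = 1 / m\<^sup>2"
    by (simp add: power_int_minus divide_inverse)
  ultimately show ?thesis
    unfolding D_def[symmetric] t_def[symmetric] m_def[symmetric] by (simp add: mult.commute)
qed

end
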